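(* Let $\mathcal G$ be a hereditary graph class of bounded expansion. There is an algorithm that, given an instance $(D,r,k)$ of \textsc{$k$-Internal Out-Branching} whose underlying undirected graph belongs to $\mathcal G$, runs in polynomial time and either correctly decides whether $(D,r,k)$ is a yes-instance, or outputs an instance $(D',r,k)$ of \textsc{$k$-Internal Out-Branching} that is a yes-instance if and only if $(D,r,k)$ is, where $|V(D')|\le c\cdot k$ for a constant $c$ depending only on $\mathcal G$, and $D'$ is an induced subgraph of $D$.
   Context: \textsc{$k$-Internal Out-Branching}: given a directed graph $D$, a root $r\in V(D)$ and a nonnegative integer $k$, decide whether $D$ has an outbranching rooted at $r$ with at least $k$ internal vertices. An outbranching rooted at $r$ is a spanning subgraph $T$ of $D$ whose underlying undirected graph is a tree with all arcs oriented away from $r$; a vertex is internal if its out-degree in $T$ is positive. A graph class is hereditary if it is closed under taking induced subgraphs. For an integer $s\ge 0$, a graph $H$ is an $s$-shallow minor of $G$ if there are pairwise disjoint sets $I_u\subseteq V(G)$ ($u\in V(H)$), each inducing a connected subgraph of radius at most $s$, such that for every edge $uv$ of $H$ there is an edge of $G$ between $I_u$ and $I_v$. For a class $\mathcal G$, $\nabla_s(\mathcal G)$ is the supremum of $|E(H)|/|V(H)|$ over all $s$-shallow minors $H$ of graphs in $\mathcal G$; $\mathcal G$ has bounded expansion if $\nabla_s(\mathcal G)$ is finite for every $s$. *)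

theory Defs
  imports
    "Graph_Theory.Graph_Theory"
    "HOL-Computational_Algebra.Polynomial"
    "HOL-Library.Extended_Nonnegative_Real"
    "HOL-Library.Log_Nat"
begin

section \<open>Undirected graphs and bounded expansion\<close>

text \<open>
  Finite simple undirected graphs are represented, as in Graph_Theory, by finite loop-free symmetric
  digraphs (locale \<^locale>\<open>pair_graph\<close>); every undirected edge is a pair of opposite arcs.
  The underlying undirected graph of a digraph \<open>D\<close> is \<^const>\<open>mk_symmetric\<close> \<open>D\<close>.
\<close>

definition edges :: "'a pair_pre_digraph \<Rightarrow> 'a set set" where
  "edges G = (\<lambda>(u, v). {u, v}) ` parcs G"

definition hop_dist :: "('a, 'b) pre_digraph \<Rightarrow> 'a \<Rightarrow> 'a \<Rightarrow> ereal" where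
  "hop_dist G = wf_digraph.\<mu> G (\<lambda>_. 1)"

definition radius :: "('a, 'b) pre_digraph \<Rightarrow> ereal" where
  "radius G = (INF u\<in>verts G. SUP v\<in>verts G. hop_dist G u v)"

definition shallow_minor :: "nat \<Rightarrow> 'b pair_pre_digraph \<Rightarrow> 'a pair_pre_digraph \<Rightarrow> bool" where
  "shallow_minor s H G \<longleftrightarrow>
     (\<exists>I :: 'b \<Rightarrow> 'a set.
        (\<forall>u\<in>pverts H. I u \<subseteq> pverts G) \<and>
        (\<forall>u\<in>pverts H. \<forall>v\<in>pverts H. u \<noteq> v \<longrightarrow> I u \<inter> I v = {}) \<and>
        (\<forall>u\<in>pverts H. Digraph_Component.connected (with_proj G \<restriction> I u) \<and>
                       radius (with_proj G \<restriction> I u) \<le> ereal (real s)) \<and>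
        (\<forall>(u, v)\<in>parcs H. \<exists>x\<in>I u. \<exists>y\<in>I v. (x, y) \<in> parcs G))"

text \<open>
  A graph class is a set of graphs whose vertices are natural numbers. This loses no generality, as
  graphs are finite; closure under isomorphism is not required. For the same reason it suffices to
  consider minors on natural numbers. The density of the graph without vertices is undefined, so it
  is left out of the supremum.
\<close>

type_synonym graph_class = "nat pair_pre_digraph set"

definition hereditary :: "graph_class \<Rightarrow> bool" where
  "hereditary \<G> \<longleftrightarrow>
     (\<forall>G\<in>\<G>. \<forall>H. induced_subgraph (with_proj H) (with_proj G) \<longrightarrow> H \<in> \<G>)"

definition nabla :: "nat \<Rightarrow> graph_class \<Rightarrow> ennreal" where
  "nabla s \<G> =
     (SUP H \<in> {H :: nat pair_pre_digraph. pair_graph H \<and> pverts H \<noteq> {} \<and>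
                 (\<exists>G\<in>\<G>. shallow_minor s H G)}.
        ennreal (real (card (edges H)) / real (card (pverts H))))"

definition bounded_expansion :: "graph_class \<Rightarrow> bool" where
  "bounded_expansion \<G> \<longleftrightarrow> (\<forall>s. nabla s \<G> < \<infinity>)"


section \<open>Internal out-branchings\<close>

text \<open>
  Graph_Theory's \<^const>\<open>tree\<close> forbids only directed cycles, and counts the two arcs of an
  undirected edge as a cycle. A cycle of an undirected graph is therefore a cycle of its symmetric
  digraph that has length at least 3.
\<close>

definition undirected_tree :: "'a pair_pre_digraph \<Rightarrow> bool" where
  "undirected_tree G \<longleftrightarrow>
     Digraph_Component.connected (with_proj G) \<and>
     \<not> (\<exists>p. pre_digraph.cycle (with_proj G) p \<and> length p \<ge> 3)"

text \<open>
  An arc of a tree is oriented away from \<open>r\<close> if its tail is closer to \<open>r\<close> than its head, where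
  distances are those of the undirected tree.
\<close>

definition outbranching :: "'a pair_pre_digraph \<Rightarrow> 'a \<Rightarrow> 'a pair_pre_digraph \<Rightarrow> bool" where
  "outbranching D r T \<longleftrightarrow>
     spanning (with_proj T) (with_proj D) \<and>
     undirected_tree (mk_symmetric (with_proj T)) \<and>
     (\<forall>(u, v)\<in>parcs T.
        hop_dist (with_proj (mk_symmetric (with_proj T))) r u
          < hop_dist (with_proj (mk_symmetric (with_proj T))) r v)"

definition internal_verts :: "'a pair_pre_digraph \<Rightarrow> 'a set" where
  "internal_verts T = {v \<in> pverts T. out_degree (with_proj T) v > 0}"

definition iob_instance :: "'a pair_pre_digraph \<Rightarrow> 'a \<Rightarrow> nat \<Rightarrow> bool" where
  "iob_instance D r k \<longleftrightarrow> pair_digraph D \<and> r \<in> pverts D"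

definition iob_yes :: "'a pair_pre_digraph \<Rightarrow> 'a \<Rightarrow> nat \<Rightarrow> bool" where
  "iob_yes D r k \<longleftrightarrow> (\<exists>T. outbranching D r T \<and> card (internal_verts T) \<ge> k)"


section \<open>A machine model for polynomial time\<close>

text \<open>
  Algorithms are while-programs for a random access machine with unbounded natural numbers, finitely
  many registers and finitely many arrays. The arithmetic operations are addition and truncated
  subtraction, and every operation costs one unit. Without multiplication a single operation
  lengthens the binary representation of the largest number present by at most one bit, so
  polynomial time on this machine, measured in the bit length of the input, coincides with
  polynomial time on Turing machines.
\<close>

type_synonym name = string

datatype exp =
    Num nat
  | Reg name
  | Elem name exp
  | Plus exp exp
  | Monus exp exp

datatype com =
    Skip
  | Assign name exp
  | Update name exp exp
  | Seq com com
  | Cond exp com com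
  | While exp com

type_synonym state = "(name \<Rightarrow> nat) \<times> (name \<Rightarrow> nat \<Rightarrow> nat)"

fun val :: "exp \<Rightarrow> state \<Rightarrow> nat" where
  "val (Num n) s = n"
| "val (Reg x) s = fst s x"
| "val (Elem A e) s = snd s A (val e s)"
| "val (Plus e f) s = val e s + val f s"
| "val (Monus e f) s = val e s - val f s"

fun cost :: "exp \<Rightarrow> nat" where
  "cost (Num n) = 1"
| "cost (Reg x) = 1"
| "cost (Elem A e) = 1 + cost e"
| "cost (Plus e f) = 1 + cost e + cost f"
| "cost (Monus e f) = 1 + cost e + cost f"

text \<open>
  \<open>exec c s t s'\<close>: started in \<open>s\<close>, the program \<open>c\<close> halts in \<open>s'\<close> after \<open>t\<close> time units. A test
  succeeds if its value is nonzero.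
\<close>

inductive exec :: "com \<Rightarrow> state \<Rightarrow> nat \<Rightarrow> state \<Rightarrow> bool" where
  Skip: "exec Skip s 1 s"
| Assign: "exec (Assign x e) (R, M) (1 + cost e) (R(x := val e (R, M)), M)"
| Update: "exec (Update A e f) (R, M) (1 + cost e + cost f)
             (R, M(A := (M A)(val e (R, M) := val f (R, M))))"
| Seq: "exec c s t s' \<Longrightarrow> exec d s' t' s'' \<Longrightarrow> exec (Seq c d) s (t + t') s''"
| CondTrue: "val e s \<noteq> 0 \<Longrightarrow> exec c s t s' \<Longrightarrow> exec (Cond e c d) s (1 + cost e + t) s'"
| CondFalse: "val e s = 0 \<Longrightarrow> exec d s t s' \<Longrightarrow> exec (Cond e c d) s (1 + cost e + t) s'"
| WhileFalse: "val e s = 0 \<Longrightarrow> exec (While e c) s (1 + cost e) s"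
| WhileTrue: "val e s \<noteq> 0 \<Longrightarrow> exec c s t s' \<Longrightarrow> exec (While e c) s' t' s'' \<Longrightarrow>
                exec (While e c) s (1 + cost e + t + t') s''"

inductive_cases exec_elims:
  "exec Skip s t s'"
  "exec (Assign x e) s t s'"
  "exec (Update A e f) s t s'"
  "exec (Seq c d) s t s'"
  "exec (Cond e c d) s t s'"
  "exec (While e c) s t s'"

lemma exec_deterministic:
  "exec c s t s' \<Longrightarrow> exec c s u s'' \<Longrightarrow> t = u \<and> s' = s''"
proof (induction arbitrary: u s'' rule: exec.induct)
  case (Seq c s t s' d t' s2)
  from Seq.prems show ?case by (rule exec_elims) (metis Seq.IH)
next
  case (CondTrue e s c t s' d)
  from CondTrue.prems show ?case
    by (rule exec_elims) (use CondTrue.hyps(1) in \<open>auto dest: CondTrue.IH\<close>)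
next
  case (CondFalse e s d t s' c)
  from CondFalse.prems show ?case
    by (rule exec_elims) (use CondFalse.hyps(1) in \<open>auto dest: CondFalse.IH\<close>)
next
  case (WhileFalse e s c)
  from WhileFalse.prems show ?case by (rule exec_elims) (use WhileFalse.hyps in simp_all)
next
  case (WhileTrue e s c t s' t' s2)
  from WhileTrue.prems show ?case
  proof (rule exec_elims)
    fix v r v'
    assume u: "u = Suc (cost e + v + v')" and "exec c s v r" and rest: "exec (While e c) r v' s''"
    from WhileTrue.IH(1)[OF this(2)] have "t = v" "r = s'" by simp_all
    with rest u show ?thesis using WhileTrue.IH(2)[of v' s''] by simp
  qed (use WhileTrue.hyps(1) in simp)
next
  case (Skip s)
  then show ?case by (rule exec_elims) simp
next
  case (Assign x e R M)
  then show ?case by (rule exec_elims) simp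
next
  case (Update A e f R M)
  then show ?case by (rule exec_elims) simp
qed

text \<open>
  The input is a list of numbers, stored in the array \<open>in\<close> with its length in the register \<open>in\<close>;
  everything else is initially 0. The output is returned in the same way in \<open>out\<close>.
\<close>

definition input_state :: "nat list \<Rightarrow> state" where
  "input_state xs =
     ((\<lambda>x. if x = ''in'' then length xs else 0),
      (\<lambda>A i. if A = ''in'' \<and> i < length xs then xs ! i else 0))"

definition output_of :: "state \<Rightarrow> nat list" where
  "output_of s = map (snd s ''out'') [0..<fst s ''out'']"

definition computes_in :: "com \<Rightarrow> nat list \<Rightarrow> nat \<Rightarrow> nat list \<Rightarrow> bool" where
  "computes_in c xs t ys \<longleftrightarrow> (\<exists>s. exec c (input_state xs) t s \<and> output_of s = ys)"

text \<open>Every number is charged its binary digits and one separator.\<close>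

definition bit_size :: "nat list \<Rightarrow> nat" where
  "bit_size xs = (\<Sum>x\<leftarrow>xs. floorlog 2 x + 1)"

text \<open>Vertices and arcs are listed without repetition, but in an arbitrary order.\<close>

definition encodes :: "nat list \<Rightarrow> nat pair_pre_digraph \<Rightarrow> nat \<Rightarrow> nat \<Rightarrow> bool" where
  "encodes xs D r k \<longleftrightarrow>
     (\<exists>vs as. distinct vs \<and> set vs = pverts D \<and> distinct as \<and> set as = parcs D \<and>
        xs = [r, k, length vs, length as] @ vs @ concat (map (\<lambda>(u, v). [u, v]) as))"

end

theory Submission
  imports Defs
begin

text \<open>
  Two vertices with the same in- and out-neighbours are twins. If \<open>v\<close> has more twins than incident
  arcs, deleting \<open>v\<close> preserves the answer. One pass over the vertices performs these deletions,
  sparing the root; "twin" and "incident" always refer to the original digraph.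
  If \<open>D\<close> has an out-branching but none with \<open>k\<close> internal vertices, it has a vertex cover \<open>S\<close> of
  size at most \<open>2k\<close>. Assign to as many vertices outside \<open>S\<close> as possible pairwise different pairs
  of their neighbours. The pairs are the edges of a 1-shallow minor on \<open>S\<close>, so they are linear in
  \<open>|S|\<close> many, and every vertex without a pair has a clique of the minor as its neighbourhood. A sparse
  graph has a linear number of cliques, each of bounded size, hence there are linearly many twin
  classes outside \<open>S\<close>, each of bounded size after the deletions. A larger rest therefore proves a
  yes-instance, and \<open>S\<close> need never be computed.
\<close>

section \<open>Out-branchings as parent functions\<close>

text \<open>The rank decreasing towards the root makes local surgery on out-branchings easy: after
  rehanging a vertex it suffices to adjust one rank, and the internal vertices are simply the image
  of the parent function. The deletions are justified on every finite loop-free digraph; sparsity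
  enters only in the size bound, so the class reaches the program as a single number with which the
  remaining vertices are compared. The threshold for a deletion is the degree of the vertex because
  this is what a local exchange argument can pay for. In the size bound the degree is controlled
  exactly for the vertices without a pair, and only these have to be counted through twin classes.
  Reachability from the root is tested separately: without any out-branching there is no maximal one
  from which a vertex cover could be read off.\<close>

definition branching :: "'a set \<Rightarrow> ('a \<times> 'a) set \<Rightarrow> 'a \<Rightarrow> ('a \<Rightarrow> 'a) \<Rightarrow> bool" where
  "branching V A r f \<longleftrightarrow>
     r \<in> V \<and> (\<forall>v\<in>V - {r}. f v \<in> V \<and> (f v, v) \<in> A) \<and> (\<exists>d :: 'a \<Rightarrow> nat. \<forall>v\<in>V - {r}. d (f v) < d v)"

text \<open>An arbitrary rank only certifies that the parent steps end in \<open>r\<close>. Counting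
  these steps gives a rank that drops by exactly one, as needed to compute distances in the
  tree.\<close>

lemma branching_height:
  assumes "branching V A r f"
  obtains h :: "'a \<Rightarrow> nat" where "h r = 0" "\<And>v. v \<in> V - {r} \<Longrightarrow> h v = Suc (h (f v))"
proof -
  from assms obtain d :: "'a \<Rightarrow> nat"
    where d: "\<And>v. v \<in> V - {r} \<Longrightarrow> d (f v) < d v" and V: "\<And>v. v \<in> V - {r} \<Longrightarrow> f v \<in> V"
    unfolding branching_def by blast
  have ex: "\<exists>n. (f ^^ n) v = r" if "v \<in> V" for v
    using that
  proof (induction "d v" arbitrary: v rule: less_induct)
    case less
    show ?case
    proof (cases "v = r")
      case True
      then show ?thesis by (intro exI[of _ 0]) simp
    next
      case False
      with less.prems have v: "v \<in> V - {r}" by simp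
      from less.hyps[OF d[OF v] V[OF v]] obtain n where "(f ^^ n) (f v) = r" by blast
      then show ?thesis by (intro exI[of _ "Suc n"]) (simp add: funpow_Suc_right del: funpow.simps)
    qed
  qed
  define h where "h v = (LEAST n. (f ^^ n) v = r)" for v
  show thesis
  proof
    show "h r = 0" unfolding h_def by (rule Least_eq_0) simp
    fix v assume v: "v \<in> V - {r}"
    from ex v obtain n where n: "(f ^^ n) v = r" by blast
    have "h v = Suc (LEAST n. (f ^^ Suc n) v = r)"
      unfolding h_def by (rule Least_Suc[where P="\<lambda>n. (f ^^ n) v = r", OF n]) (use v in auto)
    then show "h v = Suc (h (f v))"
      by (simp add: h_def funpow_Suc_right del: funpow.simps)
  qed
qed

section \<open>Distances as lengths of shortest walks\<close>

lemma hop_dist_conv_INF: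
  assumes "pair_wf_digraph G"
  shows "hop_dist (with_proj G) u v =
    (INF p\<in>{p. pre_digraph.awalk (with_proj G) u p v}. ereal (real (length p)))"
proof -
  interpret pair_wf_digraph G by fact
  have "awalk_cost (\<lambda>_. 1) p = real (length p)" for p
    by (induction p) auto
  then show ?thesis
    unfolding hop_dist_def \<mu>_def by simp
qed

lemma hop_dist_eqI:
  assumes "pair_wf_digraph G" "pre_digraph.awalk (with_proj G) u p v"
    and "\<And>q. pre_digraph.awalk (with_proj G) u q v \<Longrightarrow> length p \<le> length q"
  shows "hop_dist (with_proj G) u v = ereal (real (length p))"
  unfolding hop_dist_conv_INF[OF assms(1)]
  by (rule antisym) (use assms(2,3) in \<open>auto intro!: INF_greatest intro: INF_lower2\<close>)

lemma hop_dist_realised: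
  assumes "pair_wf_digraph G" "reachable (with_proj G) u v"
  obtains p where "pre_digraph.awalk (with_proj G) u p v"
    "hop_dist (with_proj G) u v = ereal (real (length p))"
    "\<And>q. pre_digraph.awalk (with_proj G) u q v \<Longrightarrow> length p \<le> length q"
proof -
  interpret pair_wf_digraph G by fact
  from assms(2) obtain q where q: "awalk u q v" unfolding reachable_awalk by blast
  obtain p where p: "awalk u p v" "\<And>q. awalk u q v \<Longrightarrow> length p \<le> length q"
    using exists_least_iff[of "\<lambda>n. \<exists>p. awalk u p v \<and> length p = n"] q
    by (metis not_le_imp_less)
  from hop_dist_eqI[OF assms(1) p] p that show thesis by blast
qed

lemma parcs_mk_symmetric_with_proj:
  "parcs (mk_symmetric (with_proj T)) = parcs T \<union> (parcs T)\<inverse>"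
  by (force simp: mk_symmetric_def)

lemma mk_symmetric_idem: "mk_symmetric (with_proj (mk_symmetric (with_proj T))) = mk_symmetric (with_proj T)"
  by (rule pair_pre_digraph.equality) (auto simp: parcs_mk_symmetric_with_proj)

lemma connected_mk_symmetric_iff:
  "Digraph_Component.connected (with_proj (mk_symmetric (with_proj T))) \<longleftrightarrow>
   pverts T \<noteq> {} \<and> (\<forall>u\<in>pverts T. \<forall>v\<in>pverts T. reachable (with_proj (mk_symmetric (with_proj T))) u v)"
  by (simp add: Digraph_Component.connected_def strongly_connected_def mk_symmetric_idem)

lemma pair_wf_mk_symmetric:
  "pair_wf_digraph T \<Longrightarrow> pair_wf_digraph (mk_symmetric (with_proj T))"
  using wf_digraph.wellformed_mk_symmetric wf_digraph_wp_iff by blast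

lemma pcas_nth:
  assumes "pcas u p v" "Suc i < length p"
  shows "fst (p ! Suc i) = snd (p ! i)"
  using assms
proof (induction p arbitrary: u i)
  case (Cons e p)
  then show ?case by (cases i; cases p) auto
qed simp

lemma pcas_hd_last: "pcas u p v \<Longrightarrow> p \<noteq> [] \<Longrightarrow> fst (hd p) = u \<and> snd (last p) = v"
  by (induction p arbitrary: u) auto

text \<open>The depth \<open>h\<close> turns out to be the distance from \<open>r\<close> in the
  symmetric closure \<open>M\<close>, which settles the orientation of the arcs; the same function
  excludes cycles.\<close>

lemma branching_imp_outbranching:
  assumes D: "pair_wf_digraph D" and finD: "finite (pverts D)" and f: "branching (pverts D) (parcs D) r f"
  defines "T \<equiv> \<lparr>pverts = pverts D, parcs = {(f v, v) | v. v \<in> pverts D - {r}}\<rparr>"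
  shows "outbranching D r T" "internal_verts T = f ` (pverts D - {r})"
proof -
  from f have r: "r \<in> pverts D" and fV: "\<And>v. v \<in> pverts D - {r} \<Longrightarrow> f v \<in> pverts D"
    and fA: "\<And>v. v \<in> pverts D - {r} \<Longrightarrow> (f v, v) \<in> parcs D"
    unfolding branching_def by auto
  obtain h :: "_ \<Rightarrow> nat" where h: "h r = 0" "\<And>v. v \<in> pverts D - {r} \<Longrightarrow> h v = Suc (h (f v))"
    using f by (rule branching_height) blast
  have wfT: "pair_wf_digraph T"
    by unfold_locales (use fV in \<open>auto simp: T_def\<close>)
  have sub: "spanning (with_proj T) (with_proj D)"
    unfolding spanning_def subgraph_def compatible_def wf_digraph_wp_iff
    using wfT D fA by (auto simp: T_def)
  define M where "M = mk_symmetric (with_proj T)"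
  have wfM: "pair_wf_digraph M" unfolding M_def by (rule pair_wf_mk_symmetric[OF wfT])
  interpret M: pair_wf_digraph M by (rule wfM)
  have VM: "pverts M = pverts D" by (simp add: M_def T_def)
  have AM: "(x, y) \<in> parcs M \<longleftrightarrow> (y \<in> pverts D - {r} \<and> x = f y) \<or> (x \<in> pverts D - {r} \<and> y = f x)" for x y
    by (auto simp: M_def parcs_mk_symmetric_with_proj T_def)
  have down: "\<exists>p. M.awalk r p v \<and> length p = h v" if "v \<in> pverts D" for v
    using that
  proof (induction "h v" arbitrary: v rule: less_induct)
    case less
    show ?case
    proof (cases "v = r")
      case True
      then show ?thesis using r by (intro exI[of _ "[]"]) (auto simp: M.awalk_Nil_iff VM h)
    next
      case False
      with less.prems have v: "v \<in> pverts D - {r}" by simp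
      with less.hyps[of "f v"] fV[OF v] h(2)[OF v] obtain p
        where p: "M.awalk r p (f v)" "length p = h (f v)" by auto
      have "M.awalk (f v) [(f v, v)] v"
        using v fV by (auto simp: M.awalk_simps AM VM)
      with p h(2)[OF v] show ?thesis by (intro exI[of _ "p @ [(f v, v)]"]) auto
    qed
  qed
  \<comment> \<open>Along an arc of \<open>M\<close> the depth grows by at most one, so no walk is
    faster than the one found in \<open>down\<close>.\<close>
  have short: "h w \<le> h x + length p" if "M.awalk x p w" for x p w
    using that
  proof (induction p arbitrary: x)
    case Nil then show ?case by (auto simp: M.awalk_simps)
  next
    case (Cons e p)
    then obtain y where e: "e = (x, y)" "(x, y) \<in> parcs M" "M.awalk y p w"
      by (cases e) (auto simp: M.awalk_simps)
    then have "h y \<le> Suc (h x)" using h(2) by (auto simp: AM)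
    with Cons.IH[OF e(3)] show ?case by simp
  qed
  have hop: "hop_dist (with_proj M) r v = ereal (real (h v))" if "v \<in> pverts D" for v
  proof -
    from down[OF that] obtain p where p: "M.awalk r p v" "length p = h v" by blast
    show ?thesis
      using hop_dist_eqI[OF wfM p(1)] short[of r _ v] h(1) p(2) by simp
  qed
  have sym: "sym (parcs M)" by (auto simp: sym_def AM)
  have conn: "Digraph_Component.connected (with_proj M)"
    unfolding M_def connected_mk_symmetric_iff
  proof (intro conjI ballI)
    show "pverts T \<noteq> {}" using r by (auto simp: T_def)
    fix u v assume uv: "u \<in> pverts T" "v \<in> pverts T"
    have "reachable (with_proj M) r u" "reachable (with_proj M) r v"
      using down uv by (auto simp: M.reachable_awalk T_def)
    moreover have "symmetric (with_proj M)" using sym by (simp add: symmetric_def)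
    ultimately show "reachable (with_proj (mk_symmetric (with_proj T))) u v"
      unfolding M_def[symmetric] by (blast intro: symmetric_reachable M.reachable_trans)
  qed
  \<comment> \<open>At a vertex of maximal depth on the cycle, the cyclic predecessor and successor
    must both be its parent. Length at least 3 makes these two positions different, against the
    distinctness of the vertices.\<close>
  have acyc: False if c: "M.cycle p" and len: "length p \<ge> 3" for p
  proof -
    from c obtain u where u: "M.awalk u p u" "distinct (tl (pawalk_verts u p))" "p \<noteq> []"
      unfolding M.cycle_def by auto
    from u(1) have cas: "pcas u p u" by auto
    have "pawalk_verts u p = fst (hd p) # map snd p"
      using M.awalk_verts_conv'[OF cas] u(3) by simp
    with u(2) have dist: "distinct (map snd p)" by simp
    define n where "n = length p"
    have n: "n \<ge> 3" using len n_def by simp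
    define prev where "prev i = (if i = 0 then n - 1 else i - 1)" for i
    have prev: "prev i < n" if "i < n" for i using that n by (auto simp: prev_def)
    have tail: "fst (p ! i) = snd (p ! prev i)" if "i < n" for i
    proof (cases i)
      case 0
      then show ?thesis using pcas_hd_last[OF cas u(3)] u(3)
        by (simp add: prev_def n_def hd_conv_nth last_conv_nth)
    next
      case (Suc j)
      then show ?thesis using pcas_nth[OF cas, of j] that by (simp add: prev_def n_def)
    qed
    have arc: "(snd (p ! prev i), snd (p ! i)) \<in> parcs M" if "i < n" for i
    proof -
      have "p ! i \<in> parcs M" using u(1) that unfolding n_def by (meson M.awalkE' nth_mem subsetD)
      then show ?thesis using tail[OF that] by (metis prod.collapse)
    qed
    obtain i where i: "i < n" "\<And>j. j < n \<Longrightarrow> h (snd (p ! j)) \<le> h (snd (p ! i))"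
    proof -
      have "0 \<in> {..<n}" using n by auto
      then have "Max ((\<lambda>j. h (snd (p ! j))) ` {..<n}) \<in> (\<lambda>j. h (snd (p ! j))) ` {..<n}"
        by (intro Max_in) auto
      then obtain i where i: "i < n" "Max ((\<lambda>j. h (snd (p ! j))) ` {..<n}) = h (snd (p ! i))"
        by blast
      have "h (snd (p ! j)) \<le> h (snd (p ! i))" if "j < n" for j
        unfolding i(2)[symmetric] using that by (intro Max_ge) auto
      with i(1) that show thesis by blast
    qed
    define i' where "i' = (if Suc i = n then 0 else Suc i)"
    have i': "i' < n" "prev i' = i" using i(1) n by (auto simp: i'_def prev_def)
    have "snd (p ! prev i) = f (snd (p ! i))"
      using arc[OF i(1)] i(2)[OF prev[OF i(1)]] h(2)[of "snd (p ! prev i)"] by (auto simp: AM)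
    moreover have "snd (p ! i') = f (snd (p ! i))"
      using arc[OF i'(1)] i(2)[OF i'(1)] h(2)[of "snd (p ! i')"] unfolding i'(2) by (auto simp: AM)
    ultimately have "map snd p ! prev i = map snd p ! i'"
      using prev[OF i(1)] i'(1) by (simp add: n_def)
    then have "prev i = i'"
      using dist prev[OF i(1)] i'(1) by (subst (asm) nth_eq_iff_index_eq) (auto simp: n_def)
    then show False using n i(1) by (auto simp: prev_def i'_def split: if_splits)
  qed
  show "outbranching D r T"
    unfolding outbranching_def undirected_tree_def M_def[symmetric]
  proof (intro conjI ballI)
    show "case e of (u, v) \<Rightarrow> hop_dist (with_proj M) r u < hop_dist (with_proj M) r v"
      if "e \<in> parcs T" for e
    proof -
      from that obtain v where v: "e = (f v, v)" "v \<in> pverts D - {r}" by (auto simp: T_def)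
      show ?thesis using hop[OF fV[OF v(2)]] hop[of v] v h(2)[OF v(2)] by simp
    qed
  qed (use sub conn acyc in auto)
  have out: "out_arcs (with_proj T) x = (\<lambda>v. (x, v)) ` {v \<in> pverts D - {r}. f v = x}" for x
    by (auto simp: out_arcs_def T_def)
  show "internal_verts T = f ` (pverts D - {r})"
  proof (intro equalityI subsetI)
    fix x assume "x \<in> internal_verts T"
    then have "out_arcs (with_proj T) x \<noteq> {}"
      by (auto simp: internal_verts_def out_degree_def)
    then show "x \<in> f ` (pverts D - {r})" unfolding out by auto
  next
    fix x assume "x \<in> f ` (pverts D - {r})"
    then have "x \<in> pverts T" "out_arcs (with_proj T) x \<noteq> {}" "finite (out_arcs (with_proj T) x)"
      using fV finD unfolding out by (auto simp: T_def)
    then show "x \<in> internal_verts T"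
      by (simp add: internal_verts_def out_degree_def card_gt_0_iff)
  qed
qed

text \<open>The rank \<open>d\<close> is the distance from \<open>r\<close> in the underlying tree.
  That \<open>d r = 0\<close> is recorded because it rules out arcs into \<open>r\<close>.\<close>

lemma outbranching_unique_parent:
  assumes T: "outbranching D r T" and r: "r \<in> pverts T"
  obtains d :: "'a \<Rightarrow> nat" where "d r = 0" "\<And>x y. (x, y) \<in> parcs T \<Longrightarrow> d x < d y"
    "\<And>v. v \<in> pverts T - {r} \<Longrightarrow> \<exists>!u. (u, v) \<in> parcs T"
proof -
  define M where "M = mk_symmetric (with_proj T)"
  from T have wfT: "pair_wf_digraph T"
    by (simp add: outbranching_def spanning_def subgraph_def wf_digraph_wp_iff)
  have wfM: "pair_wf_digraph M" unfolding M_def by (rule pair_wf_mk_symmetric[OF wfT])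
  interpret M: pair_wf_digraph M by (rule wfM)
  have VM: "pverts M = pverts T" by (simp add: M_def)
  have AM: "(x, y) \<in> parcs M \<longleftrightarrow> (x, y) \<in> parcs T \<or> (y, x) \<in> parcs T" for x y
    by (auto simp: M_def parcs_mk_symmetric_with_proj)
  from T have conn: "reachable (with_proj M) x y" if "x \<in> pverts T" "y \<in> pverts T" for x y
    using that unfolding outbranching_def undirected_tree_def connected_mk_symmetric_iff M_def by blast
  from T have acyc: "\<not> (M.cycle p \<and> 3 \<le> length p)" for p
    unfolding outbranching_def undirected_tree_def M_def by blast
  define d where "d x = (LEAST n. \<exists>p. M.awalk r p x \<and> length p = n)" for x
  have d: "\<exists>p. M.awalk r p x \<and> length p = d x" "hop_dist (with_proj M) r x = ereal (real (d x))"
    "\<And>q. M.awalk r q x \<Longrightarrow> d x \<le> length q"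
    if x: "x \<in> pverts T" for x
  proof -
    from conn[OF r x] obtain p where p: "M.awalk r p x"
      "hop_dist (with_proj M) r x = ereal (real (length p))"
      "\<And>q. M.awalk r q x \<Longrightarrow> length p \<le> length q"
      by (rule hop_dist_realised[OF wfM]) blast
    have "d x = length p" unfolding d_def by (rule Least_equality) (use p in auto)
    with p show "\<exists>p. M.awalk r p x \<and> length p = d x" "hop_dist (with_proj M) r x = ereal (real (d x))"
      "\<And>q. M.awalk r q x \<Longrightarrow> d x \<le> length q" by auto
  qed
  have dT: "d x < d y" if "(x, y) \<in> parcs T" for x y
  proof -
    have "x \<in> pverts T" "y \<in> pverts T" using that wfT pair_wf_digraph.wellformed' by fast+
    moreover have "hop_dist (with_proj M) r x < hop_dist (with_proj M) r y"
      using T that unfolding outbranching_def M_def by blast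
    ultimately show ?thesis using d(2) by simp
  qed
  have dM: "d y \<le> Suc (d x)" if "(x, y) \<in> parcs M" for x y
  proof -
    have xy: "x \<in> pverts T" "y \<in> pverts T" using that M.wellformed' VM by blast+
    from d(1)[OF xy(1)] obtain p where p: "M.awalk r p x" "length p = d x" by blast
    have "M.awalk x [(x, y)] y" using that xy by (simp add: M.awalk_simps VM)
    then have "M.awalk r (p @ [(x, y)]) y" using p(1) by auto
    from d(3)[OF xy(2) this] p(2) show ?thesis by simp
  qed
  \<comment> \<open>The last arc of a shortest walk to \<open>x\<close> starts closer to
    \<open>r\<close>; in the orientation away from \<open>x\<close> it would contradict
    \<open>dT\<close>.\<close>
  have parent: "\<exists>u. (u, x) \<in> parcs T" if x: "x \<in> pverts T - {r}" for x
  proof -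
    from d(1) x obtain p where p: "M.awalk r p x" "length p = d x" by blast
    have "p \<noteq> []" using p(1) x by (auto simp: M.awalk_simps)
    then obtain q e where q: "p = q @ [e]" by (metis rev_exhaust)
    from p(1) q have e: "M.awalk r q (fst e)" "e \<in> parcs M" "snd e = x"
      by (auto simp: M.awalk_simps)
    then have "fst e \<in> pverts T" using M.wellformed(1) VM by blast
    from d(3)[OF this e(1)] p(2) q have "d (fst e) < d x" by simp
    with dT[of x "fst e"] e have "(fst e, x) \<in> parcs T"
      by (metis AM not_less_iff_gr_or_eq prod.collapse)
    then show ?thesis ..
  qed
  \<comment> \<open>Two parents are both strictly closer to \<open>r\<close> than \<open>v\<close>.
    The vertices closer than \<open>v\<close> are connected to \<open>r\<close> through their own
    parents, so a path between the two parents avoids \<open>v\<close> and closes to a cycle through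
    it. As the parents differ, this cycle has at least three arcs.\<close>
  have unique: "u = u'" if u: "(u, v) \<in> parcs T" and u': "(u', v) \<in> parcs T" for u u' v
  proof (rule ccontr)
    assume ne: "u \<noteq> u'"
    define B where "B = {x \<in> pverts T. d x < d v}"
    define N where "N = \<lparr>pverts = B, parcs = parcs M \<inter> B \<times> B\<rparr>"
    have wfN: "pair_wf_digraph N" by unfold_locales (auto simp: N_def)
    interpret N: pair_wf_digraph N by (rule wfN)
    have up: "reachable (with_proj N) r x" if "x \<in> B" for x
      using that
    proof (induction "d x" arbitrary: x rule: less_induct)
      case less
      show ?case
      proof (cases "x = r")
        case True
        moreover have "x \<in> pverts N" using less.prems by (simp add: N_def)
        ultimately show ?thesis by auto
      next
        case False
        with less.prems parent[of x] obtain y where y: "(y, x) \<in> parcs T" by (auto simp: B_def)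
        from dT[OF y] less.prems y have yB: "y \<in> B"
          using pair_wf_digraph.wellformed'[OF wfT] by (auto simp: B_def)
        have "(y, x) \<in> parcs N" using y yB less.prems by (auto simp: N_def AM)
        then have "reachable (with_proj N) y x" by (intro N.reachable_adjI) auto
        with less.hyps[OF dT[OF y] yB] show ?thesis by (rule N.reachable_trans)
      qed
    qed
    have uB: "u \<in> B" "u' \<in> B" using u u' dT pair_wf_digraph.wellformed'[OF wfT] by (auto simp: B_def)
    have "symmetric (with_proj N)" by (auto simp: symmetric_def sym_def N_def AM)
    with up uB have "reachable (with_proj N) u u'"
      by (blast intro: symmetric_reachable N.reachable_trans)
    then obtain p where p: "N.apath u p u'" by (auto simp: N.reachable_apath)
    then have "p \<noteq> []" using ne by (auto simp: N.apath_simps)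
    have "subgraph (with_proj N) (with_proj M)"
      unfolding subgraph_def compatible_def wf_digraph_wp_iff using wfN wfM
      by (auto simp: N_def B_def VM)
    then have pM: "M.awalk u p u'"
      using p by (auto simp: N.apath_def intro: M.subgraph_awalk_imp_awalk)
    have "set (pawalk_verts u p) \<subseteq> pverts N" using p by (auto simp: N.apath_def)
    then have vp: "v \<notin> set (pawalk_verts u p)" by (auto simp: B_def N_def)
    define c where "c = (v, u) # p @ [(u', v)]"
    have "M.awalk u' [(u', v)] v" "(v, u) \<in> parcs M"
      using u u' M.wellformed' by (auto simp: M.awalk_simps AM VM)
    then have pv: "M.awalk u (p @ [(u', v)]) v" using pM M.awalk_appendI by blast
    with \<open>(v, u) \<in> parcs M\<close> have c: "M.awalk v c v"
      unfolding c_def by (subst M.awalk_Cons_iff) simp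
    have "pawalk_verts u (p @ [(u', v)]) = pawalk_verts u p @ [v]"
      using pM pv by (subst M.awalk_verts_append) auto
    then have "distinct (tl (pawalk_verts v c))"
      using p vp by (simp add: c_def N.apath_def)
    with c have "M.cycle c" unfolding M.cycle_def by (auto simp: c_def)
    moreover have "length c \<ge> 3" using \<open>p \<noteq> []\<close> by (cases p) (auto simp: c_def)
    ultimately show False using acyc by blast
  qed
  have "M.awalk r [] r" using r by (simp add: M.awalk_simps VM)
  then have "d r = 0" using d(3)[OF r, of "[]"] by simp
  moreover have "\<exists>!u. (u, v) \<in> parcs T" if "v \<in> pverts T - {r}" for v
    using parent[OF that] unique by blast
  ultimately show thesis using dT by (intro that[of d]) blast+
qed

lemma outbranching_imp_branching:
  assumes T: "outbranching D r T" and r: "r \<in> pverts D"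
  obtains f where "branching (pverts D) (parcs D) r f" "internal_verts T \<subseteq> f ` (pverts D - {r})"
proof -
  from T have wfT: "pair_wf_digraph T" and VT: "pverts T = pverts D" and AT: "parcs T \<subseteq> parcs D"
    by (auto simp: outbranching_def spanning_def subgraph_def wf_digraph_wp_iff)
  from r have r': "r \<in> pverts T" by (simp add: VT)
  obtain d :: "'a \<Rightarrow> nat" where d: "d r = 0" "\<And>x y. (x, y) \<in> parcs T \<Longrightarrow> d x < d y"
    "\<And>v. v \<in> pverts T - {r} \<Longrightarrow> \<exists>!u. (u, v) \<in> parcs T"
    by (rule outbranching_unique_parent[OF T r']) blast
  define f where "f v = (THE u. (u, v) \<in> parcs T)" for v
  have f: "(f v, v) \<in> parcs T" if "v \<in> pverts T - {r}" for v
    unfolding f_def using d(3)[OF that] by (rule theI')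
  have f_eq: "x = f v" if "(x, v) \<in> parcs T" for x v
  proof -
    have "v \<in> pverts T - {r}"
      using d(1) d(2)[OF that] pair_wf_digraph.in_arcsD2[OF wfT that] by auto
    then show ?thesis using f[of v] d(3)[of v] that by blast
  qed
  show thesis
  proof
    show "branching (pverts D) (parcs D) r f"
      unfolding branching_def using r f AT d(2) pair_wf_digraph.in_arcsD1[OF wfT] VT by blast
    show "internal_verts T \<subseteq> f ` (pverts D - {r})"
    proof
      fix x assume "x \<in> internal_verts T"
      then have "out_arcs (with_proj T) x \<noteq> {}" by (auto simp: internal_verts_def out_degree_def)
      then obtain v where v: "(x, v) \<in> parcs T" by (auto simp: out_arcs_def)
      then have "v \<in> pverts D - {r}" using d(1) d(2)[OF v] pair_wf_digraph.in_arcsD2[OF wfT v] VT by auto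
      with f_eq[OF v] show "x \<in> f ` (pverts D - {r})" by blast
    qed
  qed
qed

text \<open>From here on out-branchings occur only as parent functions: the vertices with a child
  form the image of \<open>f\<close>.\<close>

lemma iob_yes_iff_branching:
  assumes "pair_digraph D" "r \<in> pverts D"
  shows "iob_yes D r k \<longleftrightarrow>
    (\<exists>f. branching (pverts D) (parcs D) r f \<and> k \<le> card (f ` (pverts D - {r})))"
proof
  interpret pair_digraph D by fact
  assume "iob_yes D r k"
  then obtain T where T: "outbranching D r T" "k \<le> card (internal_verts T)"
    unfolding iob_yes_def by blast
  obtain f where f: "branching (pverts D) (parcs D) r f" "internal_verts T \<subseteq> f ` (pverts D - {r})"
    using T(1) assms(2) by (rule outbranching_imp_branching)
  from card_mono[OF _ f(2)] T(2) f(1)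
  show "\<exists>f. branching (pverts D) (parcs D) r f \<and> k \<le> card (f ` (pverts D - {r}))"
    using pair_finite_verts by (meson finite_Diff finite_imageI order_trans)
next
  interpret pair_digraph D by fact
  assume "\<exists>f. branching (pverts D) (parcs D) r f \<and> k \<le> card (f ` (pverts D - {r}))"
  then show "iob_yes D r k"
    unfolding iob_yes_def
    using branching_imp_outbranching[OF pair_wf_digraph pair_finite_verts] by (smt (verit))
qed

section \<open>Deleting twins\<close>

definition twins :: "('a \<times> 'a) set \<Rightarrow> 'a \<Rightarrow> 'a \<Rightarrow> bool" where
  "twins E u v \<longleftrightarrow> E\<inverse> `` {u} = E\<inverse> `` {v} \<and> E `` {u} = E `` {v}"

definition total_degree :: "('a \<times> 'a) set \<Rightarrow> 'a \<Rightarrow> nat" where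
  "total_degree E v = card (E\<inverse> `` {v}) + card (E `` {v})"

lemma twinsD:
  assumes "twins E u v"
  shows "(x, u) \<in> E \<longleftrightarrow> (x, v) \<in> E" "(u, x) \<in> E \<longleftrightarrow> (v, x) \<in> E"
  using assms unfolding twins_def by blast+

lemma branchingI:
  fixes d :: "'a \<Rightarrow> nat"
  assumes "r \<in> V" "\<And>v. v \<in> V - {r} \<Longrightarrow> f v \<in> V" "\<And>v. v \<in> V - {r} \<Longrightarrow> (f v, v) \<in> A"
    "\<And>v. v \<in> V - {r} \<Longrightarrow> d (f v) < d v"
  shows "branching V A r f"
  using assms unfolding branching_def by blast

lemma branching_mono: "branching V A r f \<Longrightarrow> A \<inter> V \<times> V \<subseteq> B \<Longrightarrow> branching V B r f"
  unfolding branching_def by blast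

text \<open>The parent of \<open>u\<close> also has an arc to the twin \<open>v\<close>, so
  \<open>v\<close> can be hung beside \<open>u\<close> as a leaf, with the rank of
  \<open>u\<close>.\<close>

lemma branching_add_twin:
  assumes f: "branching (V - {v}) E r f" and v: "v \<in> V" "v \<noteq> r"
    and u: "u \<in> V" "u \<noteq> v" "u \<noteq> r" "twins E u v"
  shows "branching V E r (f(v := f u))" "f ` (V - {v} - {r}) \<subseteq> f(v := f u) ` (V - {r})"
proof -
  have rV: "r \<in> V" and fV: "\<And>w. w \<in> V - {v} - {r} \<Longrightarrow> f w \<in> V - {v} \<and> (f w, w) \<in> E"
    using f unfolding branching_def by auto
  obtain d :: "'a \<Rightarrow> nat" where d: "\<And>w. w \<in> V - {v} - {r} \<Longrightarrow> d (f w) < d w"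
    using f unfolding branching_def by auto
  have "(f u, v) \<in> E" using fV[of u] u twinsD[OF u(4)] by auto
  moreover have "f u \<noteq> v" "f u \<in> V" using fV[of u] u by auto
  ultimately show "branching V E r (f(v := f u))"
    using rV fV d u(1,2,3)
    by (intro branchingI[where d = "d(v := d u)"]) (auto split: if_splits)
  show "f ` (V - {v} - {r}) \<subseteq> f(v := f u) ` (V - {r})"
    by auto
qed

lemma branching_delete_leaf:
  assumes f: "branching V E r f" and v: "v \<noteq> r" "v \<notin> f ` (V - {r})"
  shows "branching (V - {v}) E r f"
  using assms unfolding branching_def by auto

text \<open>Transport of a branching along an automorphism. An involution is its own inverse, so
  conjugation reads \<open>s \<circ> f \<circ> s\<close>, with rank
  \<open>d \<circ> s\<close>.\<close>

lemma branching_image: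
  assumes f: "branching V E r f" and s: "bij_betw s V V" "s r = r" "\<And>x. x \<in> V \<Longrightarrow> s (s x) = x"
    and hom: "\<And>x y. (x, y) \<in> E \<Longrightarrow> (s x, s y) \<in> E"
  shows "branching V E r (s \<circ> f \<circ> s)"
proof -
  obtain d :: "'a \<Rightarrow> nat" where d: "\<And>w. w \<in> V - {r} \<Longrightarrow> d (f w) < d w"
    using f unfolding branching_def by auto
  have fV: "r \<in> V" "\<And>w. w \<in> V - {r} \<Longrightarrow> f w \<in> V \<and> (f w, w) \<in> E"
    using f unfolding branching_def by auto
  have sV: "s w \<in> V" if "w \<in> V" for w using that s(1) by (auto simp: bij_betw_def)
  have sr: "s w \<in> V - {r}" if "w \<in> V - {r}" for w
    using that sV[of w] s(2) s(3)[of w] by auto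
  have "(s (f (s w)), w) \<in> E" if "w \<in> V - {r}" for w
    using hom[of "f (s w)" "s w"] fV(2)[OF sr[OF that]] s(3)[of w] that by auto
  then show ?thesis
    using fV(1) fV(2)[OF sr] sV d[OF sr] s(3)
    by (intro branchingI[where d = "d \<circ> s"]) simp_all
qed

text \<open>At most \<^term>\<open>card (E `` {v})\<close> twins have a child, since children are not shared. More than
  \<^term>\<open>card (E\<inverse> `` {v})\<close> childless twins cannot all have different parents, and a childless vertex
  with a sibling can be exchanged with \<open>v\<close> and deleted.\<close>

lemma branching_delete_twin:
  assumes f: "branching V E r f" and fin: "finite V" "finite E" and irr: "\<And>x. (x, x) \<notin> E"
    and v: "v \<in> V" "v \<noteq> r" and many: "total_degree E v < card {u \<in> V - {r}. twins E u v}"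
  obtains f' where "branching (V - {v}) E r f'"
    "card (f' ` (V - {v} - {r})) = card (f ` (V - {r}))"
proof -
  define W where "W = {u \<in> V - {r}. twins E u v}"
  define I where "I = f ` (V - {r})"
  have fV: "r \<in> V" "\<And>w. w \<in> V - {r} \<Longrightarrow> f w \<in> V \<and> (f w, w) \<in> E"
    using f unfolding branching_def by auto
  have finW: "finite W" using fin by (simp add: W_def)
  have "card (W \<inter> I) \<le> card (E `` {v})"
  proof -
    have "W \<inter> I \<subseteq> f ` (E `` {v} \<inter> (V - {r}))"
    proof
      fix w assume w: "w \<in> W \<inter> I"
      then obtain c where c: "c \<in> V - {r}" "w = f c" by (auto simp: I_def)
      with fV(2)[OF c(1)] w have "(v, c) \<in> E" using twinsD(2)[of E w v c] by (auto simp: W_def)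
      with c show "w \<in> f ` (E `` {v} \<inter> (V - {r}))" by auto
    qed
    then have "card (W \<inter> I) \<le> card (E `` {v} \<inter> (V - {r}))"
      using fin by (intro surj_card_le) auto
    also have "\<dots> \<le> card (E `` {v})" using fin by (intro card_mono finite_Image) auto
    finally show ?thesis .
  qed
  moreover have "card W = card (W \<inter> I) + card (W - I)"
    using card_Int_Diff[OF finW, of I] .
  ultimately have "card (E\<inverse> `` {v}) < card (W - I)"
    using many unfolding W_def[symmetric] total_degree_def by linarith
  moreover have "f ` (W - I) \<subseteq> E\<inverse> `` {v}"
    using fV(2) twinsD(1)[of E _ v] by (auto simp: W_def)
  moreover have "finite (E\<inverse> `` {v})" using fin by (intro finite_Image) simp
  ultimately have "\<not> inj_on f (W - I)"
    by (meson card_inj_on_le not_less)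
  then obtain w1 w2 where w: "w1 \<in> W - I" "w2 \<in> W - I" "w1 \<noteq> w2" "f w1 = f w2"
    unfolding inj_on_def by blast
  \<comment> \<open>The transposition of \<open>v\<close> and \<open>w1\<close>, or the identity if
    they coincide. It preserves arcs because twins in a loop-free digraph are nonadjacent.\<close>
  define s where "s x = (if x = v then w1 else if x = w1 then v else x)" for x
  have w1: "w1 \<in> V" "w1 \<noteq> r" "twins E w1 v" and w2: "w2 \<in> V" "w2 \<noteq> r" using w by (auto simp: W_def)
  have ss: "s (s x) = x" for x by (simp add: s_def)
  have sV: "s x \<in> V" if "x \<in> V" for x using that v w1 by (auto simp: s_def)
  have bij: "bij_betw s V V" by (rule bij_betw_byWitness[of _ s]) (use ss sV in auto)
  have sr: "s r = r" using v w1 by (auto simp: s_def)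
  have hom: "(s x, s y) \<in> E" if "(x, y) \<in> E" for x y
    using that irr twinsD[OF w1(3)] by (auto simp: s_def)
  define g where "g = s \<circ> f \<circ> s"
  have g: "branching V E r g" unfolding g_def
    using f bij sr by (rule branching_image) (use ss hom in auto)
  have sim: "s ` (V - {r}) = V - {r}"
  proof -
    have "inj_on s V" "s ` V = V" using bij by (auto simp: bij_betw_def)
    then show ?thesis using inj_on_image_set_diff[of s V V "{r}"] sr \<open>branching V E r g\<close>
      by (auto simp: branching_def)
  qed
  have gi: "g ` (V - {r}) = s ` I"
    unfolding g_def I_def image_comp[symmetric] sim ..
  have "v \<notin> s ` I"
  proof
    assume "v \<in> s ` I"
    then obtain x where "x \<in> I" "s x = v" by blast
    then have "w1 \<in> I" using ss[of x] by (auto simp: s_def split: if_splits)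
    with w show False by blast
  qed
  with gi have leaf: "v \<notin> g ` (V - {r})" by simp
  \<comment> \<open>In the new tree \<open>s w2\<close> is a sibling of \<open>v\<close>, so
    dropping \<open>v\<close> leaves the image unchanged. The sibling is \<open>s w2\<close> and not
    \<open>w2\<close>, which may be \<open>v\<close> itself.\<close>
  have "g v = g (s w2)" using w(4) by (simp add: g_def ss) (simp add: s_def)
  moreover have "s w2 \<in> V - {v} - {r}"
  proof -
    have "s w2 \<noteq> v" using w(3) by (auto simp: s_def)
    moreover have "s w2 \<noteq> r" using v w1 w2 by (auto simp: s_def)
    ultimately show ?thesis using sV[OF w2(1)] by simp
  qed
  ultimately have "g v \<in> g ` (V - {v} - {r})" by (rule image_eqI)
  then have "g ` insert v (V - {v} - {r}) = g ` (V - {v} - {r})" by (simp add: insert_absorb)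
  moreover have "insert v (V - {v} - {r}) = V - {r}" using v by auto
  ultimately have "g ` (V - {v} - {r}) = s ` I" using gi by simp
  moreover have "inj s" by (rule inj_on_inverseI[of _ s]) (rule ss)
  ultimately have "card (g ` (V - {v} - {r})) = card I" by (simp add: card_image inj_on_subset)
  with branching_delete_leaf[OF g v(2) leaf] show thesis unfolding I_def by (rule that)
qed

section \<open>A small vertex cover\<close>

text \<open>In an out-branching with the maximum number of internal vertices, the leaves with a sibling are
  independent: rehanging the head of an arc between two of them gains an internal vertex.\<close>

lemma vertex_cover_of_few_internal:
  assumes f0: "branching V E r f0" and fin: "finite V"
    and irr: "\<And>x. (x, x) \<notin> E"
    and few: "\<And>f. branching V E r f \<Longrightarrow> card (f ` (V - {r})) < k"
  obtains S where "S \<subseteq> V" "r \<in> S" "card S \<le> 2 * k" "\<And>x y. x \<in> V - S \<Longrightarrow> y \<in> V - S \<Longrightarrow> (x, y) \<notin> E"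
proof -
  obtain f where f: "branching V E r f"
    and max: "\<And>g. branching V E r g \<Longrightarrow> card (g ` (V - {r})) \<le> card (f ` (V - {r}))"
    using ex_has_greatest_nat[of "branching V E r" f0 "\<lambda>f. card (f ` (V - {r}))" k] f0 few
    by (meson less_imp_le)
  define I where "I = f ` (V - {r})"
  define U where "U = {v \<in> V - {r} - I. \<exists>w\<in>V - {r} - {v}. f w = f v}"
  have fV: "r \<in> V" "\<And>w. w \<in> V - {r} \<Longrightarrow> f w \<in> V \<and> (f w, w) \<in> E"
    using f unfolding branching_def by auto
  obtain d :: "'a \<Rightarrow> nat" where d: "\<And>w. w \<in> V - {r} \<Longrightarrow> d (f w) < d w"
    using f unfolding branching_def by auto
  have finI: "finite I" using fin by (simp add: I_def)
  have indep: "(x, u) \<notin> E" if x: "x \<in> U" and u: "u \<in> U" for x u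
  proof
    assume e: "(x, u) \<in> E"
    then have "x \<noteq> u" using irr by auto
    have uV: "u \<in> V - {r}" "u \<notin> I" and xV: "x \<in> V" "x \<notin> I" using x u by (auto simp: U_def)
    from u obtain w where w: "w \<in> V - {r} - {u}" "f w = f u" by (auto simp: U_def)
    \<comment> \<open>As \<open>u\<close> has no child, its rank can be raised above that of
      \<open>x\<close> without affecting any other vertex. The sibling \<open>w\<close> keeps the
      old parent of \<open>u\<close> internal while \<open>x\<close> becomes internal.\<close>
    define d' where "d' = d(u := Suc (d x))"
    have "f y \<noteq> u" if "y \<in> V - {r}" for y using that uV(2) by (auto simp: I_def)
    then have "d' ((f(u := x)) y) < d' y" if "y \<in> V - {r}" for y
      using d[OF that] that \<open>x \<noteq> u\<close> by (auto simp: d'_def)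
    then have "branching V E r (f(u := x))"
      by (rule branchingI[where d = d', rotated 3]) (use fV e xV in \<open>auto split: if_splits\<close>)
    moreover have "insert x I \<subseteq> f(u := x) ` (V - {r})"
    proof
      fix y assume "y \<in> insert x I"
      then consider "y = x" | z where "y = f z" "z \<in> V - {r}" by (auto simp: I_def)
      then show "y \<in> f(u := x) ` (V - {r})"
      proof cases
        case 1 then show ?thesis using uV by (auto intro!: rev_image_eqI[of u])
      next
        case 2
        show ?thesis
        proof (cases "z = u")
          case True
          then show ?thesis using 2 w by (auto intro!: rev_image_eqI[of w])
        next
          case False
          then show ?thesis using 2 by (auto intro!: rev_image_eqI[of z])
        qed
      qed
    qed
    then have "card (insert x I) \<le> card (f(u := x) ` (V - {r}))"
      using fin by (intro card_mono) auto
    ultimately show False using max[of "f(u := x)"] xV finI unfolding I_def[symmetric] by simp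
  qed
  \<comment> \<open>Outside \<open>U\<close> lie the root, the internal vertices and the childless
    vertices without a sibling. The last kind is mapped injectively to parents, which gives
    \<open>1 + 2 * card I\<close>; this is below \<open>2 * k\<close> since
    \<open>card I < k\<close>.\<close>
  have "V - U \<subseteq> insert r (I \<union> (V - {r} - I - U))" by auto
  moreover have "card (V - {r} - I - U) \<le> card I"
  proof (rule card_inj_on_le[of f])
    show "inj_on f (V - {r} - I - U)" unfolding inj_on_def U_def by force
    show "f ` (V - {r} - I - U) \<subseteq> I" by (auto simp: I_def)
  qed (rule finI)
  moreover have "card (insert r (I \<union> (V - {r} - I - U))) \<le> Suc (card I + card (V - {r} - I - U))"
    using card_Un_le[of I "V - {r} - I - U"] fin finI by (simp add: card_insert_if)
  moreover have "finite (insert r (I \<union> (V - {r} - I - U)))" using fin finI by simp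
  ultimately have "card (V - U) \<le> 1 + (card I + card I)"
    using card_mono[of "insert r (I \<union> (V - {r} - I - U))" "V - U"] by linarith
  then have "card (V - U) \<le> 2 * k" using few[OF f] unfolding I_def[symmetric] by linarith
  moreover have "r \<in> V - U" using fV by (auto simp: U_def)
  ultimately show thesis using indep by (intro that[of "V - U"]) auto
qed

section \<open>Counting vertices outside a vertex cover\<close>

definition clique :: "'a set set \<Rightarrow> 'a set \<Rightarrow> bool" where
  "clique F K \<longleftrightarrow> (\<forall>x\<in>K. \<forall>y\<in>K. x \<noteq> y \<longrightarrow> {x, y} \<in> F)"

text \<open>Double counting: the degrees inside \<open>K\<close> sum to twice the number of edges,
  so they cannot all exceed \<open>2 * C\<close>.\<close>

lemma low_degree_vertex:
  assumes fin: "finite F" "finite K" "K \<noteq> {}" and two: "\<And>e. e \<in> F \<Longrightarrow> card e = 2"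
    and sparse: "card {e \<in> F. e \<subseteq> K} \<le> C * card K"
  obtains x where "x \<in> K" "card {e \<in> F. e \<subseteq> K \<and> x \<in> e} \<le> 2 * C"
proof (rule ccontr)
  let ?F = "{e \<in> F. e \<subseteq> K}"
  assume "\<not> thesis"
  with that have big: "2 * C < card {e \<in> F. e \<subseteq> K \<and> x \<in> e}" if "x \<in> K" for x
    using that by (meson not_le)
  have "2 * C * card K = (\<Sum>x\<in>K. 2 * C)" by simp
  also have "\<dots> < (\<Sum>x\<in>K. card {e \<in> ?F. x \<in> e})"
    by (rule sum_strict_mono) (use fin big in \<open>auto simp: conj_assoc\<close>)
  also have "\<dots> = (\<Sum>e\<in>?F. card {x \<in> K. x \<in> e})"
    by (rule sum_multicount_gen[where k = "\<lambda>e. card {x \<in> K. x \<in> e}"])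
      (use fin in auto)
  also have "\<dots> = (\<Sum>e\<in>?F. 2)"
  proof (rule sum.cong)
    fix e assume e: "e \<in> ?F"
    then have "{x \<in> K. x \<in> e} = e" by auto
    with e two show "card {x \<in> K. x \<in> e} = 2" by simp
  qed simp
  also have "\<dots> \<le> 2 * C * card K" using sparse by simp
  finally show False by simp
qed

lemma clique_neighbours_le:
  assumes "finite F" "\<And>e. e \<in> F \<Longrightarrow> card e = 2" "finite K" "x \<in> K"
  shows "card {y \<in> K - {x}. {x, y} \<in> F} \<le> card {e \<in> F. e \<subseteq> K \<and> x \<in> e}"
  by (rule card_inj_on_le[of "\<lambda>y. {x, y}"])
    (use assms in \<open>auto simp: inj_on_def doubleton_eq_iff\<close>)

text \<open>A vertex of low degree in the clique is adjacent to all the others.\<close>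

lemma card_clique_le:
  assumes fin: "finite F" "finite K" and two: "\<And>e. e \<in> F \<Longrightarrow> card e = 2"
    and sparse: "K \<noteq> {} \<Longrightarrow> card {e \<in> F. e \<subseteq> K} \<le> C * card K" and K: "clique F K"
  shows "card K \<le> 2 * C + 1"
proof (cases "K = {}")
  case False
  then obtain x where x: "x \<in> K" "card {e \<in> F. e \<subseteq> K \<and> x \<in> e} \<le> 2 * C"
    using low_degree_vertex[OF fin False two sparse] by blast
  have "{y \<in> K - {x}. {x, y} \<in> F} = K - {x}" using K x(1) by (auto simp: clique_def)
  with clique_neighbours_le[OF fin(1) two fin(2) x(1)] x have "card (K - {x}) \<le> 2 * C" by simp
  then show ?thesis using x(1) fin(2) by simp
qed simp

text \<open>Degeneracy argument: remove a vertex \<open>x\<close> of low degree; every clique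
  containing it consists of \<open>x\<close> and a subset of its at most \<open>2 * C\<close>
  neighbours. The additive 1 is the empty clique. Sparsity is assumed for all subsets because the
  induction passes to them.\<close>

lemma card_cliques_le:
  assumes fin: "finite F" "finite S" and two: "\<And>e. e \<in> F \<Longrightarrow> card e = 2"
    and sparse: "\<And>K. K \<noteq> {} \<Longrightarrow> K \<subseteq> S \<Longrightarrow> card {e \<in> F. e \<subseteq> K} \<le> C * card K"
  shows "card {K. K \<subseteq> S \<and> clique F K} \<le> 1 + 2 ^ (2 * C) * card S"
  using fin(2) sparse
proof (induction "card S" arbitrary: S)
  case 0
  then have "{K. K \<subseteq> S \<and> clique F K} \<subseteq> {{}}" by auto
  then have "card {K. K \<subseteq> S \<and> clique F K} \<le> card {{} :: 'a set}" by (intro card_mono) auto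
  then show ?case by simp
next
  case (Suc n)
  then have ne: "S \<noteq> {}" by auto
  from Suc.prems(2)[OF this] obtain x where x: "x \<in> S" "card {e \<in> F. e \<subseteq> S \<and> x \<in> e} \<le> 2 * C"
    using low_degree_vertex[OF fin(1) Suc.prems(1) ne two] by blast
  define N where "N = {y \<in> S - {x}. {x, y} \<in> F}"
  have N: "card N \<le> 2 * C" "finite N"
    using clique_neighbours_le[OF fin(1) two Suc.prems(1) x(1)] x(2) Suc.prems(1)
    by (auto simp: N_def)
  have "{K. K \<subseteq> S \<and> clique F K} \<subseteq> {K. K \<subseteq> S - {x} \<and> clique F K} \<union> insert x ` Pow N"
  proof
    fix K assume K: "K \<in> {K. K \<subseteq> S \<and> clique F K}"
    show "K \<in> {K. K \<subseteq> S - {x} \<and> clique F K} \<union> insert x ` Pow N"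
    proof (cases "x \<in> K")
      case True
      with K have "K - {x} \<in> Pow N" by (auto simp: N_def clique_def)
      moreover have "K = insert x (K - {x})" using True by auto
      ultimately show ?thesis by blast
    qed (use K in auto)
  qed
  then have "card {K. K \<subseteq> S \<and> clique F K} \<le> card ({K. K \<subseteq> S - {x} \<and> clique F K} \<union> insert x ` Pow N)"
    using Suc.prems(1) N(2) by (intro card_mono) auto
  also have "\<dots> \<le> card {K. K \<subseteq> S - {x} \<and> clique F K} + card (insert x ` Pow N)"
    by (rule card_Un_le)
  also have "card (insert x ` Pow N) \<le> 2 ^ card N"
    using card_image_le[of "Pow N" "insert x"] N(2) by (simp add: card_Pow)
  also have "(2::nat) ^ card N \<le> 2 ^ (2 * C)" using N(1) by (intro power_increasing) auto
  also have "card {K. K \<subseteq> S - {x} \<and> clique F K} \<le> 1 + 2 ^ (2 * C) * card (S - {x})"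
    using Suc.hyps(2) x(1) Suc.prems by (intro Suc.hyps(1)) auto
  also have "1 + 2 ^ (2 * C) * card (S - {x}) + 2 ^ (2 * C) = 1 + 2 ^ (2 * C) * card S"
    by (simp add: card.remove[OF Suc.prems(1) x(1)] del: card_Diff_insert card_Diff_singleton)
  finally show ?case by simp
qed

lemma card_le_fibres:
  assumes "finite B" "\<And>v. v \<in> B \<Longrightarrow> card {u \<in> B. \<phi> u = \<phi> v} \<le> m"
  shows "card B \<le> m * card (\<phi> ` B)"
proof -
  have B: "(\<Union>t\<in>\<phi> ` B. {u \<in> B. \<phi> u = t}) = B" by auto
  have "card B \<le> (\<Sum>t\<in>\<phi> ` B. card {u \<in> B. \<phi> u = t})"
    using card_UN_le[of "\<phi> ` B" "\<lambda>t. {u \<in> B. \<phi> u = t}"] assms(1) unfolding B by simp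
  also have "\<dots> \<le> (\<Sum>t\<in>\<phi> ` B. m)" by (rule sum_mono) (use assms(2) in auto)
  finally show ?thesis by (simp add: mult.commute)
qed

text \<open>Contracting every \<open>v \<in> J\<close> into its neighbour \<open>a v\<close> produces the edge between \<open>a v\<close> and
  \<open>b v\<close> of a 1-shallow minor on \<open>S\<close>. This is all that is used of bounded expansion.\<close>

definition contraction_sparse :: "'a set \<Rightarrow> ('a \<times> 'a) set \<Rightarrow> nat \<Rightarrow> bool" where
  "contraction_sparse V E C \<longleftrightarrow>
     (\<forall>S J a b. S \<subseteq> V \<longrightarrow> S \<noteq> {} \<longrightarrow> J \<subseteq> V - S \<longrightarrow> inj_on (\<lambda>v. {a v, b v}) J \<longrightarrow>
        (\<forall>v\<in>J. a v \<noteq> b v \<and> a v \<in> S \<and> b v \<in> S \<and> {(a v, v), (b v, v)} \<subseteq> E \<union> E\<inverse>) \<longrightarrow>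
        card J \<le> C * card S)"

text \<open>Per vertex of \<open>S\<close>: 1 for the cover itself, \<open>C\<close> for the
  vertices with a pair, and a product for the rest. There \<open>4 * C + 3\<close> bounds a twin
  class, \<open>4 ^ (2 * C + 1)\<close> the choices of an in- and an out-neighbourhood inside one
  clique, and \<open>1 + 2 ^ (2 * C)\<close> the cliques.\<close>

definition kernel_factor :: "nat \<Rightarrow> nat" where
  "kernel_factor C = 1 + C + (4 * C + 3) * (4 ^ (2 * C + 1) * (1 + 2 ^ (2 * C)))"

text \<open>\<open>A\<close> need only meet each twin class outside \<open>S\<close> in few
  vertices, with twins and degrees taken in the whole digraph. The bound therefore fits the outcome
  of deletions that are made without knowing \<open>S\<close>.\<close>

lemma kernel_size:
  assumes fin: "finite V" "finite E" and EV: "E \<subseteq> V \<times> V"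
    and sparse: "contraction_sparse V E C"
    and S: "S \<subseteq> V" "S \<noteq> {}" "\<And>x y. x \<in> V - S \<Longrightarrow> y \<in> V - S \<Longrightarrow> (x, y) \<notin> E"
    and A: "A \<subseteq> V" "\<And>v. v \<in> A - S \<Longrightarrow> card {u \<in> A - S. twins E u v} \<le> total_degree E v + 1"
  shows "card A \<le> kernel_factor C * card S"
proof -
  define nb where "nb v = E\<inverse> `` {v} \<union> E `` {v}" for v
  have nbS: "nb v \<subseteq> S" if "v \<in> V - S" for v using that S(3) EV by (auto simp: nb_def)
  have finS: "finite S" using S(1) fin(1) by (rule finite_subset)
  define ok where "ok J g \<longleftrightarrow> J \<subseteq> V - S \<and> inj_on g J \<and> (\<forall>v\<in>J. g v \<subseteq> nb v \<and> card (g v) = 2)"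
    for J and g :: "'a \<Rightarrow> 'a set"
  have ok_card: "card J \<le> card V" if "ok J g" for J g
    using that fin(1) by (intro card_mono) (auto simp: ok_def)
  have "\<exists>p. (case p of (J, g) \<Rightarrow> ok J g) \<and>
      (\<forall>q. (case q of (J, g) \<Rightarrow> ok J g) \<longrightarrow> card (fst q) \<le> card (fst p))"
    by (rule ex_has_greatest_nat[where k = "({}, \<lambda>_. {})" and b = "Suc (card V)"])
      (use ok_card in \<open>auto simp: ok_def less_Suc_eq_le\<close>)
  then obtain J g where J: "ok J g" and max: "\<And>J' g'. ok J' g' \<Longrightarrow> card J' \<le> card J"
    by fastforce
  have JV: "J \<subseteq> V - S" and inj: "inj_on g J" and g: "\<And>v. v \<in> J \<Longrightarrow> g v \<subseteq> nb v \<and> card (g v) = 2"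
    using J by (auto simp: ok_def)
  have finJ: "finite J" using JV fin(1) by (meson finite_Diff finite_subset)
  define F where "F = g ` J"
  have finF: "finite F" using finJ by (simp add: F_def)
  have two: "card e = 2" if "e \<in> F" for e using that g by (auto simp: F_def)
  \<comment> \<open>The assigned vertices whose pair lies in \<open>K\<close> can be contracted onto
    \<open>K\<close> alone, so every nonempty induced subgraph of the minor is sparse, not just the
    whole.\<close>
  have spF: "card {e \<in> F. e \<subseteq> K} \<le> C * card K" if K: "K \<noteq> {}" "K \<subseteq> S" for K
  proof -
    define J' where "J' = {v \<in> J. g v \<subseteq> K}"
    have "\<forall>v\<in>J. \<exists>a b. g v = {a, b} \<and> a \<noteq> b" using g by (auto simp: card_2_iff)
    then obtain a b where ab: "\<And>v. v \<in> J \<Longrightarrow> g v = {a v, b v} \<and> a v \<noteq> b v" by metis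
    have "inj_on (\<lambda>v. {a v, b v}) J'"
      using inj ab by (auto simp: inj_on_def J'_def)
    moreover have "J' \<subseteq> V - K" using JV K by (auto simp: J'_def)
    moreover have "a v \<noteq> b v \<and> a v \<in> K \<and> b v \<in> K \<and> {(a v, v), (b v, v)} \<subseteq> E \<union> E\<inverse>"
      if "v \<in> J'" for v
      using that ab[of v] g[of v] by (auto simp: J'_def nb_def)
    ultimately have "card J' \<le> C * card K"
      using sparse K S(1) unfolding contraction_sparse_def by (meson order_trans)
    moreover have "{e \<in> F. e \<subseteq> K} = g ` J'" by (auto simp: F_def J'_def)
    moreover have "card (g ` J') \<le> card J'" using finJ by (intro card_image_le) (simp add: J'_def)
    ultimately show ?thesis by simp
  qed
  \<comment> \<open>Two neighbours of \<open>v\<close> that form no edge of \<open>F\<close> would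
    be a fresh pair for \<open>v\<close>, against the maximality of \<open>J\<close>.\<close>
  have cl: "clique F (nb v)" if v: "v \<in> V - S - J" for v
  proof -
    have "{x, y} \<in> F" if xy: "x \<in> nb v" "y \<in> nb v" "x \<noteq> y" for x y
    proof (rule ccontr)
      assume n: "{x, y} \<notin> F"
      have "ok (insert v J) (g(v := {x, y}))"
        unfolding ok_def
      proof (intro conjI ballI)
        show "inj_on (g(v := {x, y})) (insert v J)"
          using inj n v by (auto simp: inj_on_def F_def)
      qed (use JV v g xy in auto)
      from max[OF this] show False using v finJ by simp
    qed
    then show ?thesis by (auto simp: clique_def)
  qed
  have nb_le: "card (nb v) \<le> 2 * C + 1" if "v \<in> V - S - J" for v
    using card_clique_le[OF finF _ two _ cl[OF that]] spF[of "nb v"] nbS[of v] that finS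
    by (meson DiffD1 finite_subset)
  have card_J: "card J \<le> C * card S"
  proof -
    have "{e \<in> F. e \<subseteq> S} = F" using g nbS JV by (fastforce simp: F_def)
    with spF[of S] S(2) have "card F \<le> C * card S" by simp
    then show ?thesis using inj by (simp add: F_def card_image)
  qed
  define B where "B = A - S - J"
  have BV: "v \<in> V - S - J" if "v \<in> B" for v using that A(1) by (auto simp: B_def)
  have finB: "finite B" using A(1) fin(1) by (auto simp: B_def intro: finite_subset)
  \<comment> \<open>The fibres of this map are the twin classes; both components are subsets of the
    clique \<open>nb v\<close>.\<close>
  define \<phi> where "\<phi> v = (E\<inverse> `` {v}, E `` {v})" for v
  have "card {u \<in> B. \<phi> u = \<phi> v} \<le> 4 * C + 3" if v: "v \<in> B" for v
  proof -
    have "card {u \<in> B. \<phi> u = \<phi> v} \<le> card {u \<in> A - S. twins E u v}"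
      using A(1) fin(1) by (intro card_mono) (auto simp: B_def \<phi>_def twins_def intro: finite_subset)
    also have "\<dots> \<le> total_degree E v + 1" using v by (intro A(2)) (simp add: B_def)
    \<comment> \<open>A neighbour joined in both directions counts twice in the degree, whence
      \<open>2 * (2 * C + 1) + 1 = 4 * C + 3\<close>. The final 1 is \<open>v\<close> as its own
      twin.\<close>
    also have "total_degree E v \<le> card (nb v) + card (nb v)"
      unfolding total_degree_def nb_def
      by (intro add_mono card_mono) (use fin in auto)
    also have "card (nb v) \<le> 2 * C + 1" by (rule nb_le[OF BV[OF v]])
    finally show ?thesis by simp
  qed
  from card_le_fibres[OF finB this] have "card B \<le> (4 * C + 3) * card (\<phi> ` B)" .
  moreover have "card (\<phi> ` B) \<le> 4 ^ (2 * C + 1) * (1 + 2 ^ (2 * C) * card S)"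
  proof -
    define Q where "Q = {K. K \<subseteq> S \<and> clique F K}"
    have finQ: "finite Q" using finS by (simp add: Q_def)
    have "\<phi> ` B \<subseteq> (\<Union>K\<in>Q. Pow K \<times> Pow K)"
    proof
      fix t assume "t \<in> \<phi> ` B"
      then obtain v where v: "v \<in> B" "t = \<phi> v" by blast
      have "nb v \<in> Q" using cl[OF BV[OF v(1)]] nbS[of v] BV[OF v(1)] by (auto simp: Q_def)
      moreover have "t \<in> Pow (nb v) \<times> Pow (nb v)" by (auto simp: v(2) \<phi>_def nb_def)
      ultimately show "t \<in> (\<Union>K\<in>Q. Pow K \<times> Pow K)" by blast
    qed
    moreover have finK: "finite K" if "K \<in> Q" for K
      using that finS by (auto simp: Q_def intro: finite_subset)
    ultimately have "card (\<phi> ` B) \<le> card (\<Union>K\<in>Q. Pow K \<times> Pow K)"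
      using finQ by (intro card_mono) auto
    also have "\<dots> \<le> (\<Sum>K\<in>Q. card (Pow K \<times> Pow K))" by (rule card_UN_le[OF finQ])
    also have "\<dots> \<le> (\<Sum>K\<in>Q. 4 ^ (2 * C + 1))"
    proof (rule sum_mono)
      fix K assume K: "K \<in> Q"
      have le: "card K \<le> 2 * C + 1"
        by (rule card_clique_le[OF finF finK[OF K] two]) (use spF K in \<open>auto simp: Q_def\<close>)
      have "card (Pow K \<times> Pow K) = 2 ^ card K * 2 ^ card K"
        by (simp add: card_cartesian_product card_Pow finK[OF K])
      also have "\<dots> = (4::nat) ^ card K" by (simp flip: power_mult_distrib)
      also have "\<dots> \<le> 4 ^ (2 * C + 1)" using le by (intro power_increasing) auto
      finally show "card (Pow K \<times> Pow K) \<le> 4 ^ (2 * C + 1)" .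
    qed
    also have "\<dots> = 4 ^ (2 * C + 1) * card Q" by simp
    also have "card Q \<le> 1 + 2 ^ (2 * C) * card S"
      unfolding Q_def by (rule card_cliques_le[OF finF finS two spF])
    finally show ?thesis by simp
  qed
  \<comment> \<open>The cover is nonempty, so \<open>card S\<close> absorbs the 1 for the empty
    clique.\<close>
  moreover have "1 + 2 ^ (2 * C) * card S \<le> (1 + 2 ^ (2 * C)) * card S"
    using S(2) finS by (simp add: Suc_leI card_gt_0_iff)
  ultimately have "card B \<le> (4 * C + 3) * (4 ^ (2 * C + 1) * ((1 + 2 ^ (2 * C)) * card S))"
    by (meson le_trans mult_le_mono2)
  then have "card B \<le> (4 * C + 3) * (4 ^ (2 * C + 1) * (1 + 2 ^ (2 * C))) * card S"
    by (simp only: mult.assoc)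
  moreover have "card A \<le> card S + card J + card B"
  proof -
    have "A \<subseteq> S \<union> J \<union> B" by (auto simp: B_def)
    then have "card A \<le> card (S \<union> J \<union> B)"
      using finS finJ finB by (intro card_mono) auto
    also have "\<dots> \<le> card S + card J + card B"
      by (meson add_right_mono card_Un_le order_trans)
    finally show ?thesis .
  qed
  moreover have "kernel_factor C * card S = card S + C * card S
      + (4 * C + 3) * (4 ^ (2 * C + 1) * (1 + 2 ^ (2 * C))) * card S"
    unfolding kernel_factor_def by (simp only: add_mult_distrib mult_1)
  ultimately show ?thesis using card_J by linarith
qed

section \<open>Bounded expansion\<close>

lemma induce_subgraph_with_proj:
  "with_proj G \<restriction> W = with_proj \<lparr>pverts = W, parcs = parcs G \<inter> W \<times> W\<rparr>"
  by (auto simp: induce_subgraph_def with_proj_def)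

text \<open>The branch sets of the minor will be stars. The centre \<open>s\<close> is the vertex
  that bounds the infimum in \<open>radius\<close>.\<close>

lemma star_connected_radius:
  assumes s: "s \<in> W" and star: "\<And>v. v \<in> W \<Longrightarrow> v \<noteq> s \<Longrightarrow> (s, v) \<in> parcs G"
  shows "Digraph_Component.connected (with_proj G \<restriction> W)" "radius (with_proj G \<restriction> W) \<le> ereal (real 1)"
proof -
  define N where "N = \<lparr>pverts = W, parcs = parcs G \<inter> W \<times> W\<rparr>"
  have wfN: "pair_wf_digraph N" by unfold_locales (auto simp: N_def)
  interpret N: pair_wf_digraph N by (rule wfN)
  have VN: "pverts N = W" "(x, y) \<in> parcs N \<longleftrightarrow> (x, y) \<in> parcs G \<and> x \<in> W \<and> y \<in> W" for x y
    by (auto simp: N_def)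
  have walk: "\<exists>p. N.awalk s p v \<and> length p \<le> 1" if "v \<in> W" for v
  proof (cases "v = s")
    case True
    then show ?thesis using s VN by (intro exI[of _ "[]"]) (simp add: N.awalk_simps)
  next
    case False
    then show ?thesis using s that star[OF that False] VN
      by (intro exI[of _ "[(s, v)]"]) (simp add: N.awalk_simps)
  qed
  have M: "pair_wf_digraph (mk_symmetric (with_proj N))" by (rule pair_wf_mk_symmetric[OF wfN])
  have reach: "reachable (with_proj (mk_symmetric (with_proj N))) s v" if "v \<in> W" for v
  proof -
    have "reachable (with_proj N) s v" using walk[OF that] by (auto simp: N.reachable_awalk)
    then show ?thesis by (rule N.reachable_mk_symmetricI)
  qed
  have "reachable (with_proj (mk_symmetric (with_proj N))) u v" if "u \<in> W" "v \<in> W" for u v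
    using symmetric_reachable[OF symmetric_mk_symmetric reach[OF that(1)]] reach[OF that(2)]
    by (rule wf_digraph.reachable_trans[OF M[folded wf_digraph_wp_iff]])
  then show "Digraph_Component.connected (with_proj G \<restriction> W)"
    unfolding induce_subgraph_with_proj N_def[symmetric] Digraph_Component.connected_def
      strongly_connected_def using s by (auto simp: N_def)
  have "hop_dist (with_proj N) s v \<le> ereal (real 1)" if v: "v \<in> W" for v
  proof -
    from walk[OF v] obtain p where p: "N.awalk s p v" "length p \<le> 1" by blast
    have "hop_dist (with_proj N) s v \<le> ereal (real (length p))"
      unfolding hop_dist_conv_INF[OF wfN] using p(1) by (intro INF_lower) simp
    also have "\<dots> \<le> ereal (real 1)" using p(2) by simp
    finally show ?thesis .
  qed
  then have "(SUP v\<in>W. hop_dist (with_proj N) s v) \<le> ereal (real 1)" by (rule SUP_least)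
  then show "radius (with_proj G \<restriction> W) \<le> ereal (real 1)"
    unfolding induce_subgraph_with_proj N_def[symmetric] radius_def
    using s by (intro INF_lower2[of s]) (simp_all add: N_def)
qed

text \<open>Every \<open>v\<close> in \<open>J\<close> contributes its own edge, by injectivity, so
  the minor on \<open>S\<close> has density \<open>card J / card S\<close>. This is at most
  \<open>nabla 1\<close>, and \<open>C\<close> is any natural number above it, the same for the
  whole class.\<close>

lemma bounded_expansion_contraction_sparse:
  assumes "bounded_expansion \<G>"
  obtains C :: nat where "\<And>D. pair_digraph D \<Longrightarrow> mk_symmetric (with_proj D) \<in> \<G> \<Longrightarrow>
    contraction_sparse (pverts D) (parcs D) C"
proof -
  from assms have "nabla 1 \<G> < top" by (simp add: bounded_expansion_def)
  then obtain C where C: "nabla 1 \<G> < of_nat C" using ennreal_Ex_less_of_nat by auto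
  have "contraction_sparse (pverts D) (parcs D) C"
    if D: "pair_digraph D" and G: "mk_symmetric (with_proj D) \<in> \<G>" for D
    unfolding contraction_sparse_def
  proof (intro allI impI)
    interpret pair_digraph D by fact
    fix S J :: "nat set" and a b :: "nat \<Rightarrow> nat"
    assume S: "S \<subseteq> pverts D" "S \<noteq> {}" and J: "J \<subseteq> pverts D - S" and inj: "inj_on (\<lambda>v. {a v, b v}) J"
      and ab: "\<forall>v\<in>J. a v \<noteq> b v \<and> a v \<in> S \<and> b v \<in> S \<and> {(a v, v), (b v, v)} \<subseteq> parcs D \<union> (parcs D)\<inverse>"
    define H where "H = \<lparr>pverts = S, parcs = (\<lambda>v. (a v, b v)) ` J \<union> (\<lambda>v. (b v, a v)) ` J\<rparr>"
    \<comment> \<open>Each \<open>v\<close> joins only the star of \<open>a v\<close>, which keeps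
      the branch sets disjoint; the arc between \<open>v\<close> and \<open>b v\<close> then
      realises the edge.\<close>
    define I where "I s = insert s {v \<in> J. a v = s}" for s
    have finS: "finite S" using S(1) pair_finite_verts by (rule finite_subset)
    have finJ: "finite J" using J pair_finite_verts by (meson finite_Diff finite_subset)
    have H: "pair_graph H"
      by unfold_locales (use ab finS finJ in \<open>auto simp: H_def symmetric_def sym_def\<close>)
    have "edges H = (\<lambda>v. {a v, b v}) ` J"
      by (auto simp: edges_def H_def image_Un image_image insert_commute)
    then have eH: "card (edges H) = card J" using inj by (simp add: card_image)
    have sym: "(x, y) \<in> parcs (mk_symmetric (with_proj D)) \<longleftrightarrow> (x, y) \<in> parcs D \<or> (y, x) \<in> parcs D" for x y
      by (auto simp: parcs_mk_symmetric_with_proj)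
    have minor: "shallow_minor 1 H (mk_symmetric (with_proj D))"
      unfolding shallow_minor_def
    proof (intro exI[of _ I] conjI ballI impI)
      fix u assume u: "u \<in> pverts H"
      show "I u \<subseteq> pverts (mk_symmetric (with_proj D))" using u S J by (auto simp: I_def H_def)
      have "(u, v) \<in> parcs (mk_symmetric (with_proj D))" if "v \<in> I u" "v \<noteq> u" for v
        using that ab sym by (auto simp: I_def)
      then show "Digraph_Component.connected (with_proj (mk_symmetric (with_proj D)) \<restriction> I u)"
        "radius (with_proj (mk_symmetric (with_proj D)) \<restriction> I u) \<le> ereal (real 1)"
        using star_connected_radius[of u "I u"] by (simp_all add: I_def)
    next
      fix u v assume "u \<in> pverts H" "v \<in> pverts H" "u \<noteq> v"
      then show "I u \<inter> I v = {}" using J by (auto simp: I_def H_def)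
    next
      fix e assume "e \<in> parcs H"
      then obtain w where w: "w \<in> J" "e = (a w, b w) \<or> e = (b w, a w)" by (auto simp: H_def)
      have "w \<in> I (a w)" "b w \<in> I (b w)" using w(1) by (auto simp: I_def)
      moreover have "(w, b w) \<in> parcs (mk_symmetric (with_proj D))"
        "(b w, w) \<in> parcs (mk_symmetric (with_proj D))" using ab w(1) sym by auto
      ultimately show "case e of (u, v) \<Rightarrow>
          \<exists>x\<in>I u. \<exists>y\<in>I v. (x, y) \<in> parcs (mk_symmetric (with_proj D))"
        using w(2) by auto
    qed
    have "ennreal (real (card (edges H)) / real (card (pverts H))) \<le> nabla 1 \<G>"
      unfolding nabla_def using H minor G S(2) by (intro SUP_upper) (auto simp: H_def)
    also have "\<dots> \<le> of_nat C" using C by simp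
    finally have "ennreal (real (card J) / real (card S)) \<le> ennreal (real C)"
      by (simp add: eH ennreal_of_nat_eq_real_of_nat) (simp add: H_def)
    then have "real (card J) / real (card S) \<le> real C" by simp
    moreover have "card S > 0" using S(2) finS by (simp add: card_gt_0_iff)
    ultimately have "real (card J) \<le> real (C * card S)" by (simp add: field_simps)
    then show "card J \<le> C * card S" by (simp only: of_nat_le_iff)
  qed
  then show thesis by (rule that)
qed

section \<open>The reduction\<close>

text \<open>The breadth-first tree: parents precede their children on shortest walks, and the
  distance is the rank. The existence of an out-branching thus becomes a graph search that the
  program can perform.\<close>

lemma ex_branching_iff_reachable:
  assumes EV: "E \<subseteq> V \<times> V" and r: "r \<in> V"
  shows "(\<exists>f. branching V E r f) \<longleftrightarrow> V \<subseteq> E\<^sup>* `` {r}"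
proof
  assume "\<exists>f. branching V E r f"
  then obtain f and d :: "'a \<Rightarrow> nat" where fV: "\<And>w. w \<in> V - {r} \<Longrightarrow> f w \<in> V \<and> (f w, w) \<in> E"
    and d: "\<And>w. w \<in> V - {r} \<Longrightarrow> d (f w) < d w"
    unfolding branching_def by blast
  have "(r, v) \<in> E\<^sup>*" if "v \<in> V" for v
    using that
  proof (induction "d v" arbitrary: v rule: less_induct)
    case less
    show ?case
    proof (cases "v = r")
      case False
      with less.prems have v: "v \<in> V - {r}" by simp
      have "(r, f v) \<in> E\<^sup>*" using less.hyps[OF d[OF v]] fV[OF v] by blast
      then show ?thesis using fV[OF v] by (meson rtrancl.rtrancl_into_rtrancl)
    qed simp
  qed
  then show "V \<subseteq> E\<^sup>* `` {r}" by blast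
next
  assume reach: "V \<subseteq> E\<^sup>* `` {r}"
  define d where "d v = (LEAST n. (r, v) \<in> E ^^ n)" for v
  have "\<exists>u. u \<in> V \<and> (u, v) \<in> E \<and> d u < d v" if v: "v \<in> V - {r}" for v
  proof -
    have "(r, v) \<in> E\<^sup>*" using reach v by auto
    then obtain n where "(r, v) \<in> E ^^ n" by (auto dest: rtrancl_imp_relpow)
    then have dv: "(r, v) \<in> E ^^ d v" unfolding d_def by (rule LeastI)
    then obtain m where m: "d v = Suc m" using v by (cases "d v") auto
    with dv obtain u where u: "(r, u) \<in> E ^^ m" "(u, v) \<in> E" by (metis relpow_Suc_E)
    have "d u \<le> m" unfolding d_def using u(1) by (rule Least_le)
    with u m EV show ?thesis by (intro exI[of _ u]) auto
  qed
  then obtain f where "\<And>v. v \<in> V - {r} \<Longrightarrow> f v \<in> V \<and> (f v, v) \<in> E \<and> d (f v) < d v" by metis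
  with r have "branching V E r f" by (intro branchingI[where d = d]) auto
  then show "\<exists>f. branching V E r f" by blast
qed

section \<open>Greedy deletion of twins\<close>

definition delete_twin :: "('a \<times> 'a) set \<Rightarrow> 'a \<Rightarrow> 'a set \<Rightarrow> 'a \<Rightarrow> 'a set" where
  "delete_twin E r A v =
     (if v \<noteq> r \<and> total_degree E v < card {u \<in> A - {r, v}. twins E u v} then A - {v} else A)"

text \<open>Only the vertex set shrinks while \<open>E\<close> stays fixed, so twin classes and
  degrees never change during the pass. Arcs that leave the current set are harmless: they can only
  raise the threshold.\<close>

definition delete_twins :: "('a \<times> 'a) set \<Rightarrow> 'a \<Rightarrow> 'a list \<Rightarrow> 'a set" where
  "delete_twins E r vs = foldl (delete_twin E r) (set vs) vs"

lemma foldl_delete_twin_subset: "foldl (delete_twin E r) A vs \<subseteq> A"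
proof (induction vs arbitrary: A)
  case (Cons v vs)
  have "delete_twin E r A v \<subseteq> A" by (auto simp: delete_twin_def)
  with Cons[of "delete_twin E r A v"] show ?case by simp
qed simp

lemma root_in_foldl_delete_twin: "r \<in> A \<Longrightarrow> r \<in> foldl (delete_twin E r) A vs"
proof (induction vs arbitrary: A)
  case (Cons v vs)
  have "r \<in> delete_twin E r A v" using Cons.prems by (auto simp: delete_twin_def)
  from Cons.IH[OF this] show ?case by simp
qed simp

lemma delete_twins_subset: "delete_twins E r vs \<subseteq> set vs"
  unfolding delete_twins_def by (rule foldl_delete_twin_subset)

lemma root_in_delete_twins: "r \<in> set vs \<Longrightarrow> r \<in> delete_twins E r vs"
  unfolding delete_twins_def by (rule root_in_foldl_delete_twin)

text \<open>The test failed when \<open>v\<close> was examined, and later deletions can only remove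
  further twins, so a single pass is enough.\<close>

lemma few_twins_in_delete_twins:
  assumes v: "v \<in> delete_twins E r vs" "v \<noteq> r"
  shows "card {u \<in> delete_twins E r vs - {r, v}. twins E u v} \<le> total_degree E v"
proof -
  have "v \<in> set vs" using v(1) delete_twins_subset[of E r vs] by blast
  then obtain ys zs where vs: "vs = ys @ v # zs" by (meson split_list)
  define A where "A = foldl (delete_twin E r) (set vs) ys"
  have eq: "delete_twins E r vs = foldl (delete_twin E r) (delete_twin E r A v) zs"
    unfolding delete_twins_def A_def by (subst (2) vs) simp
  then have sub: "delete_twins E r vs \<subseteq> delete_twin E r A v" by (simp add: foldl_delete_twin_subset)
  then have "v \<in> delete_twin E r A v" using v(1) by blast
  then have le: "card {u \<in> A - {r, v}. twins E u v} \<le> total_degree E v"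
    using v(2) by (auto simp: delete_twin_def split: if_splits)
  have "A \<subseteq> set vs" unfolding A_def by (rule foldl_delete_twin_subset)
  then have "finite A" by (rule finite_subset) simp
  moreover have "delete_twins E r vs \<subseteq> A"
    using sub by (auto simp: delete_twin_def split: if_splits)
  ultimately have "card {u \<in> delete_twins E r vs - {r, v}. twins E u v}
      \<le> card {u \<in> A - {r, v}. twins E u v}"
    by (intro card_mono) auto
  with le show ?thesis by simp
qed

lemma delete_twin_safe:
  assumes fin: "finite A" "finite E" and irr: "\<And>x. (x, x) \<notin> E" and v: "v \<in> A"
  shows "(\<exists>f. branching (delete_twin E r A v) E r f \<and> k \<le> card (f ` (delete_twin E r A v - {r})))
    \<longleftrightarrow> (\<exists>f. branching A E r f \<and> k \<le> card (f ` (A - {r})))"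
proof (cases "v \<noteq> r \<and> total_degree E v < card {u \<in> A - {r, v}. twins E u v}")
  case True
  then have A': "delete_twin E r A v = A - {v}" by (simp add: delete_twin_def)
  \<comment> \<open>The test is strict, so some other twin of \<open>v\<close> is present;
    \<open>v\<close> can be rehung beside it.\<close>
  have "{u \<in> A - {r, v}. twins E u v} \<noteq> {}" using True by (auto simp del: Collect_empty_eq)
  then obtain u where u: "u \<in> A" "u \<noteq> v" "u \<noteq> r" "twins E u v" by auto
  have "card {u \<in> A - {r, v}. twins E u v} \<le> card {u \<in> A - {r}. twins E u v}"
    using fin(1) by (intro card_mono) auto
  then have many: "total_degree E v < card {u \<in> A - {r}. twins E u v}" using True by linarith
  show ?thesis unfolding A'
  proof
    assume "\<exists>f. branching (A - {v}) E r f \<and> k \<le> card (f ` (A - {v} - {r}))"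
    then obtain f where f: "branching (A - {v}) E r f" "k \<le> card (f ` (A - {v} - {r}))" by blast
    from branching_add_twin[OF f(1) v _ u] True
    have g: "branching A E r (f(v := f u))" "f ` (A - {v} - {r}) \<subseteq> f(v := f u) ` (A - {r})" by auto
    from g(2) fin(1) have "card (f ` (A - {v} - {r})) \<le> card (f(v := f u) ` (A - {r}))"
      by (intro card_mono) auto
    with g(1) f(2) show "\<exists>f. branching A E r f \<and> k \<le> card (f ` (A - {r}))"
      by (meson order_trans)
  next
    assume "\<exists>f. branching A E r f \<and> k \<le> card (f ` (A - {r}))"
    then obtain f where f: "branching A E r f" "k \<le> card (f ` (A - {r}))" by blast
    from True have "v \<noteq> r" by simp
    from branching_delete_twin[OF f(1) fin irr v this many] f(2)
    show "\<exists>f. branching (A - {v}) E r f \<and> k \<le> card (f ` (A - {v} - {r}))" by metis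
  qed
qed (auto simp: delete_twin_def)

lemma delete_twins_safe:
  assumes fin: "finite E" and irr: "\<And>x. (x, x) \<notin> E" and vs: "distinct vs"
  shows "(\<exists>f. branching (delete_twins E r vs) E r f \<and> k \<le> card (f ` (delete_twins E r vs - {r})))
    \<longleftrightarrow> (\<exists>f. branching (set vs) E r f \<and> k \<le> card (f ` (set vs - {r})))"
proof -
  \<comment> \<open>Generalised to any current set containing the vertices still to be examined.
    Distinctness ensures that deleting \<open>w\<close> leaves those in place.\<close>
  have "(\<exists>f. branching (foldl (delete_twin E r) A ws) E r f \<and>
        k \<le> card (f ` (foldl (delete_twin E r) A ws - {r})))
      \<longleftrightarrow> (\<exists>f. branching A E r f \<and> k \<le> card (f ` (A - {r})))"
    if "finite A" "distinct ws" "set ws \<subseteq> A" for A ws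
    using that
  proof (induction ws arbitrary: A)
    case (Cons w ws)
    have "finite (delete_twin E r A w)" "set ws \<subseteq> delete_twin E r A w" "distinct ws"
      using Cons.prems by (auto simp: delete_twin_def)
    from Cons.IH[OF this(1,3,2)]
    have "(\<exists>f. branching (foldl (delete_twin E r) A (w # ws)) E r f \<and>
        k \<le> card (f ` (foldl (delete_twin E r) A (w # ws) - {r})))
      \<longleftrightarrow> (\<exists>f. branching (delete_twin E r A w) E r f \<and> k \<le> card (f ` (delete_twin E r A w - {r})))"
      by simp
    also have "\<dots> \<longleftrightarrow> (\<exists>f. branching A E r f \<and> k \<le> card (f ` (A - {r})))"
      using Cons.prems fin irr by (intro delete_twin_safe) auto
    finally show ?case .
  qed simp
  then show ?thesis unfolding delete_twins_def using vs by simp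
qed

definition kernel :: "'a pair_pre_digraph \<Rightarrow> 'a set \<Rightarrow> 'a pair_pre_digraph" where
  "kernel D A = \<lparr>pverts = A, parcs = parcs D \<inter> A \<times> A\<rparr>"

lemma kernel_induced:
  assumes D: "pair_digraph D" and A: "A \<subseteq> pverts D" "r \<in> A"
  shows "iob_instance (kernel D A) r k" "induced_subgraph (with_proj (kernel D A)) (with_proj D)"
proof -
  interpret pair_digraph D by fact
  have "pair_digraph (kernel D A)"
    by unfold_locales
      (use pair_finite_verts pair_finite_arcs no_loops' A in \<open>auto simp: kernel_def intro: finite_subset\<close>)
  with A show "iob_instance (kernel D A) r k" by (simp add: iob_instance_def kernel_def)
  have "pair_wf_digraph (kernel D A)" by unfold_locales (auto simp: kernel_def)
  then show "induced_subgraph (with_proj (kernel D A)) (with_proj D)"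
    using A pair_wf_digraph
    by (auto simp: induced_subgraph_def subgraph_def compatible_def wf_digraph_wp_iff kernel_def)
qed

lemma iob_yes_delete_twins:
  assumes D: "pair_digraph D" and r: "r \<in> pverts D" and vs: "distinct vs" "set vs = pverts D"
  shows "iob_yes (kernel D (delete_twins (parcs D) r vs)) r k \<longleftrightarrow> iob_yes D r k"
proof -
  interpret pair_digraph D by fact
  let ?A = "delete_twins (parcs D) r vs"
  have A: "?A \<subseteq> pverts D" "r \<in> ?A"
    using delete_twins_subset[of "parcs D" r vs] root_in_delete_twins[of r vs "parcs D"] r vs(2) by auto
  have "pair_digraph (kernel D ?A)" "r \<in> pverts (kernel D ?A)"
    using kernel_induced(1)[OF D A] by (auto simp: iob_instance_def)
  then have "iob_yes (kernel D ?A) r k \<longleftrightarrow>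
      (\<exists>f. branching ?A (parcs D \<inter> ?A \<times> ?A) r f \<and> k \<le> card (f ` (?A - {r})))"
    by (simp add: iob_yes_iff_branching) (simp add: kernel_def)
  also have "\<dots> \<longleftrightarrow> (\<exists>f. branching ?A (parcs D) r f \<and> k \<le> card (f ` (?A - {r})))"
  proof -
    \<comment> \<open>A branching of \<open>?A\<close> uses only arcs with both ends in
      \<open>?A\<close>, so inducing the arcs makes no difference.\<close>
    have "branching ?A (parcs D \<inter> ?A \<times> ?A) r f \<longleftrightarrow> branching ?A (parcs D) r f" for f
      using branching_mono[of ?A "parcs D \<inter> ?A \<times> ?A" r f "parcs D"]
        branching_mono[of ?A "parcs D" r f "parcs D \<inter> ?A \<times> ?A"] by blast
    then show ?thesis by simp
  qed
  also have "\<dots> \<longleftrightarrow> (\<exists>f. branching (set vs) (parcs D) r f \<and> k \<le> card (f ` (set vs - {r})))"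
    using pair_finite_arcs no_loops' vs(1) by (intro delete_twins_safe) blast+
  also have "\<dots> \<longleftrightarrow> iob_yes D r k" unfolding vs(2) by (rule iob_yes_iff_branching[OF D r, symmetric])
  finally show ?thesis .
qed

text \<open>By contradiction: \<open>reach\<close> supplies some branching, and if all of them have
  fewer than \<open>k\<close> internal vertices, a cover of at most \<open>2 * k\<close> vertices
  exists and \<open>kernel_size\<close> limits what the deletions can leave.\<close>

lemma iob_yes_if_many_left:
  assumes D: "pair_digraph D" and r: "r \<in> pverts D" and vs: "set vs = pverts D"
    and sparse: "contraction_sparse (pverts D) (parcs D) C"
    and reach: "pverts D \<subseteq> (parcs D)\<^sup>* `` {r}"
    and big: "2 * kernel_factor C * k < card (delete_twins (parcs D) r vs)"
  shows "iob_yes D r k"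
proof (rule ccontr)
  assume no: "\<not> iob_yes D r k"
  interpret pair_digraph D by fact
  let ?A = "delete_twins (parcs D) r vs"
  have EV: "parcs D \<subseteq> pverts D \<times> pverts D" using in_arcsD1 in_arcsD2 by auto
  have irr: "(x, x) \<notin> parcs D" for x using no_loops'[of x x] by blast
  from reach ex_branching_iff_reachable[OF EV r] obtain f0 where f0: "branching (pverts D) (parcs D) r f0"
    by blast
  have few: "card (f ` (pverts D - {r})) < k" if "branching (pverts D) (parcs D) r f" for f
    using no that iob_yes_iff_branching[OF D r] by (meson not_less)
  obtain S where S: "S \<subseteq> pverts D" "r \<in> S" "card S \<le> 2 * k"
    "\<And>x y. x \<in> pverts D - S \<Longrightarrow> y \<in> pverts D - S \<Longrightarrow> (x, y) \<notin> parcs D"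
    by (rule vertex_cover_of_few_internal[OF f0 pair_finite_verts irr few]) (assumption, rule that)
  have A: "?A \<subseteq> pverts D" using delete_twins_subset[of "parcs D" r vs] vs by simp
  have finA: "finite ?A" using A pair_finite_verts by (rule finite_subset)
  have "S \<noteq> {}" using S(2) by blast
  \<comment> \<open>The 1 accounts for \<open>v\<close> as its own twin. As \<open>r\<close> lies in
    \<open>S\<close>, its exclusion from the deletion test loses nothing here.\<close>
  have few_twins: "card {u \<in> ?A - S. twins (parcs D) u v} \<le> total_degree (parcs D) v + 1"
    if v: "v \<in> ?A - S" for v
  proof -
    from v S(2) have "v \<noteq> r" by auto
    have "{u \<in> ?A - S. twins (parcs D) u v} \<subseteq> insert v {u \<in> ?A - {r, v}. twins (parcs D) u v}"
      using S(2) by blast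
    then have "card {u \<in> ?A - S. twins (parcs D) u v} \<le> card (insert v {u \<in> ?A - {r, v}. twins (parcs D) u v})"
      using finA by (intro card_mono) simp_all
    also have "\<dots> \<le> card {u \<in> ?A - {r, v}. twins (parcs D) u v} + 1"
      using finA by (simp add: card_insert_if)
    also have "\<dots> \<le> total_degree (parcs D) v + 1"
      using few_twins_in_delete_twins[of v "parcs D" r vs] v \<open>v \<noteq> r\<close> by simp
    finally show ?thesis .
  qed
  have "card ?A \<le> kernel_factor C * card S"
    by (rule kernel_size[OF pair_finite_verts pair_finite_arcs EV sparse S(1) \<open>S \<noteq> {}\<close> S(4) A few_twins])
      assumption+
  also have "\<dots> \<le> kernel_factor C * (2 * k)" using S(3) by simp
  finally show False using big by simp
qed

section \<open>Loop programs\<close>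

text \<open>A fragment of the machine language with counted loops only: its programs denote total
  functions, and a polynomial time bound can be read off the syntax of those satisfying
  \<open>bounded_by\<close>.\<close>

datatype loop =
    LSkip
  | LAssign name exp
  | LUpdate name exp exp
  | LSeq loop loop (infixr \<open>;;\<close> 60)
  | LCond exp loop loop
  | LFor name name loop

primrec compile :: "loop \<Rightarrow> com" where
  "compile LSkip = Skip"
| "compile (LAssign x e) = Assign x e"
| "compile (LUpdate A e f) = Update A e f"
| "compile (c ;; d) = Seq (compile c) (compile d)"
| "compile (LCond e c d) = Cond e (compile c) (compile d)"
| "compile (LFor x b c) = Seq (Assign x (Num 0))
     (While (Monus (Reg b) (Reg x)) (Seq (compile c) (Assign x (Plus (Reg x) (Num 1)))))"

definition set_reg :: "name \<Rightarrow> nat \<Rightarrow> state \<Rightarrow> state" where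
  "set_reg x v s = ((fst s)(x := v), snd s)"

definition set_elem :: "name \<Rightarrow> nat \<Rightarrow> nat \<Rightarrow> state \<Rightarrow> state" where
  "set_elem A i v s = (fst s, (snd s)(A := (snd s A)(i := v)))"

lemma set_reg_simps [simp]:
  "fst (set_reg x v s) y = (if y = x then v else fst s y)" "snd (set_reg x v s) = snd s"
  by (auto simp: set_reg_def)

lemma set_elem_simps [simp]:
  "fst (set_elem A i v s) = fst s"
  "snd (set_elem A i v s) B = (if B = A then (snd s A)(i := v) else snd s B)"
  by (auto simp: set_elem_def)

text \<open>The bound is read once on entry and the counter is advanced from its value before the
  body. This agrees with the compiled while loop when the body writes neither register, as
  \<open>bounded_by\<close> guarantees.\<close>

primrec run :: "loop \<Rightarrow> state \<Rightarrow> state" where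
  "run LSkip s = s"
| "run (LAssign x e) s = set_reg x (val e s) s"
| "run (LUpdate A e f) s = set_elem A (val e s) (val f s) s"
| "run (c ;; d) s = run d (run c s)"
| "run (LCond e c d) s = (if val e s \<noteq> 0 then run c s else run d s)"
| "run (LFor x b c) s =
     ((\<lambda>s. set_reg x (Suc (fst s x)) (run c s)) ^^ fst s b) (set_reg x 0 s)"

primrec regs :: "loop \<Rightarrow> name set" where
  "regs LSkip = {}"
| "regs (LAssign x e) = {x}"
| "regs (LUpdate A e f) = {}"
| "regs (c ;; d) = regs c \<union> regs d"
| "regs (LCond e c d) = regs c \<union> regs d"
| "regs (LFor x b c) = insert x (regs c)"

primrec arrays :: "loop \<Rightarrow> name set" where
  "arrays LSkip = {}"
| "arrays (LAssign x e) = {}"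
| "arrays (LUpdate A e f) = {A}"
| "arrays (c ;; d) = arrays c \<union> arrays d"
| "arrays (LCond e c d) = arrays c \<union> arrays d"
| "arrays (LFor x b c) = arrays c"

text \<open>All loop bounds come from one set \<open>B\<close> of registers that the program never
  writes, so a single number limits every loop, nested ones included, during the whole run.\<close>

primrec bounded_by :: "name set \<Rightarrow> loop \<Rightarrow> bool" where
  "bounded_by B LSkip \<longleftrightarrow> True"
| "bounded_by B (LAssign x e) \<longleftrightarrow> x \<notin> B"
| "bounded_by B (LUpdate A e f) \<longleftrightarrow> True"
| "bounded_by B (c ;; d) \<longleftrightarrow> bounded_by B c \<and> bounded_by B d"
| "bounded_by B (LCond e c d) \<longleftrightarrow> bounded_by B c \<and> bounded_by B d"
| "bounded_by B (LFor x b c) \<longleftrightarrow> x \<notin> B \<and> b \<in> B \<and> x \<notin> regs c \<and> bounded_by B c"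

text \<open>The variable is a common upper bound for all loop bounds. For a loop, 6 is the
  initialisation (2) plus the failing test (4), and 8 is the test (4) plus the increment (4) of each
  round. A conditional is charged for both branches.\<close>

primrec time :: "loop \<Rightarrow> nat poly" where
  "time LSkip = 1"
| "time (LAssign x e) = [:1 + cost e:]"
| "time (LUpdate A e f) = [:1 + cost e + cost f:]"
| "time (c ;; d) = time c + time d"
| "time (LCond e c d) = [:1 + cost e:] + time c + time d"
| "time (LFor x b c) = [:6:] + [:0, 1:] * (time c + [:8:])"

lemma funpow_invariant:
  assumes "I 0 s" "\<And>i s. i < n \<Longrightarrow> I i s \<Longrightarrow> I (Suc i) (g s)"
  shows "I n ((g ^^ n) s)"
proof -
  have "I i ((g ^^ i) s)" if "i \<le> n" for i
    using that by (induction i) (use assms in auto)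
  then show ?thesis by simp
qed

lemma run_frame: "x \<notin> regs c \<Longrightarrow> fst (run c s) x = fst s x"
proof (induction c arbitrary: s)
  case (LFor y b c)
  have "(\<lambda>_ t. fst t x = fst s x) (fst s b)
    (((\<lambda>s. set_reg y (Suc (fst s y)) (run c s)) ^^ fst s b) (set_reg y 0 s))"
    by (rule funpow_invariant) (use LFor in auto)
  then show ?case by simp
qed auto

lemma run_frame_array: "A \<notin> arrays c \<Longrightarrow> snd (run c s) A = snd s A"
proof (induction c arbitrary: s)
  case (LFor y b c)
  have "(\<lambda>_ t. snd t A = snd s A) (fst s b)
    (((\<lambda>s. set_reg y (Suc (fst s y)) (run c s)) ^^ fst s b) (set_reg y 0 s))"
    by (rule funpow_invariant) (use LFor in auto)
  then show ?case by simp
qed auto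

lemma bounded_by_regs: "bounded_by B c \<Longrightarrow> regs c \<inter> B = {}"
  by (induction c) auto

lemma exec_compile:
  assumes "bounded_by B c" "\<And>b. b \<in> B \<Longrightarrow> fst s b \<le> L"
  shows "\<exists>t. t \<le> poly (time c) L \<and> exec (compile c) s t (run c s)"
  using assms
proof (induction c arbitrary: s)
  case LSkip
  then show ?case using exec.Skip by (intro exI[of _ 1]) simp
next
  case (LAssign x e)
  then show ?case using exec.Assign[of x e "fst s" "snd s"]
    by (intro exI[of _ "1 + cost e"]) (simp add: set_reg_def)
next
  case (LUpdate A e f)
  then show ?case using exec.Update[of A e f "fst s" "snd s"]
    by (intro exI[of _ "1 + cost e + cost f"]) (simp add: set_elem_def)
next
  case (LSeq c d)
  from LSeq.prems LSeq.IH(1) obtain t where t: "t \<le> poly (time c) L" "exec (compile c) s t (run c s)"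
    by fastforce
  have "fst (run c s) b \<le> L" if "b \<in> B" for b
    using LSeq.prems bounded_by_regs[of B c] that by (subst run_frame) auto
  with LSeq.prems LSeq.IH(2) obtain u
    where u: "u \<le> poly (time d) L" "exec (compile d) (run c s) u (run d (run c s))"
    by fastforce
  show ?case
    using t(1) u(1) exec.Seq[OF t(2) u(2)] by (intro exI[of _ "t + u"]) simp
next
  case (LCond e c d)
  show ?case
  proof (cases "val e s = 0")
    case True
    from LCond.prems LCond.IH(2) obtain t where t: "t \<le> poly (time d) L" "exec (compile d) s t (run d s)"
      by fastforce
    with exec.CondFalse[OF True t(2)] True show ?thesis
      by (intro exI[of _ "1 + cost e + t"]) simp
  next
    case False
    from LCond.prems LCond.IH(1) obtain t where t: "t \<le> poly (time c) L" "exec (compile c) s t (run c s)"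
      by fastforce
    with exec.CondTrue[OF False t(2)] False show ?thesis
      by (intro exI[of _ "1 + cost e + t"]) simp
  qed
next
  case (LFor x b c)
  define T where "T = poly (time c) L"
  define g where "g = (\<lambda>s. set_reg x (Suc (fst s x)) (run c s))"
  let ?w = "While (Monus (Reg b) (Reg x)) (Seq (compile c) (Assign x (Plus (Reg x) (Num 1))))"
  \<comment> \<open>Generalised to a counter with \<open>n\<close> rounds to go; the 4 pays for the
    last, failing test.\<close>
  have loop: "\<exists>t. t \<le> n * (T + 8) + 4 \<and> exec ?w s t ((g ^^ n) s)"
    if "fst s b = fst s x + n" "\<And>b. b \<in> B \<Longrightarrow> fst s b \<le> L" for n s
    using that
  proof (induction n arbitrary: s)
    case 0
    then have "exec ?w s (1 + cost (Monus (Reg b) (Reg x))) s"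
      by (intro exec.WhileFalse) simp
    then show ?case by (intro exI[of _ 4]) (simp add: numeral_eq_Suc)
  next
    case (Suc n)
    from LFor.IH[of s] LFor.prems(1) Suc.prems(2)
    obtain t where t: "t \<le> T" "exec (compile c) s t (run c s)" by (auto simp: T_def)
    have fr: "fst (run c s) y = fst s y" if "y = x \<or> y \<in> B" for y
      using that LFor.prems(1) bounded_by_regs[of B c] by (intro run_frame) auto
    have "exec (Assign x (Plus (Reg x) (Num 1))) (run c s) 4 (g s)"
      using exec.Assign[of x "Plus (Reg x) (Num 1)" "fst (run c s)" "snd (run c s)"] fr[of x]
      by (simp add: g_def set_reg_def numeral_eq_Suc)
    from exec.Seq[OF t(2) this]
    have body: "exec (Seq (compile c) (Assign x (Plus (Reg x) (Num 1)))) s (t + 4) (g s)" .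
    have "b \<noteq> x" using LFor.prems(1) by auto
    then have "fst (g s) b = fst (g s) x + n"
      using Suc.prems(1) fr[of b] LFor.prems(1) by (simp add: g_def)
    moreover have "fst (g s) y \<le> L" if "y \<in> B" for y
      using Suc.prems(2)[OF that] fr[of y] that LFor.prems(1) by (auto simp: g_def)
    ultimately obtain u where u: "u \<le> n * (T + 8) + 4" "exec ?w (g s) u ((g ^^ n) (g s))"
      using Suc.IH[of "g s"] by blast
    have "val (Monus (Reg b) (Reg x)) s \<noteq> 0" using Suc.prems(1) by simp
    from exec.WhileTrue[OF this body u(2)]
    have "exec ?w s (1 + cost (Monus (Reg b) (Reg x)) + (t + 4) + u) ((g ^^ Suc n) s)"
      by (simp add: funpow_Suc_right del: funpow.simps)
    then show ?case using t(1) u(1)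
      by (intro exI[of _ "1 + cost (Monus (Reg b) (Reg x)) + (t + 4) + u"]) simp
  qed
  have "b \<in> B" "b \<noteq> x" using LFor.prems(1) by auto
  have init: "fst (set_reg x 0 s) b = fst (set_reg x 0 s) x + fst s b"
    "\<And>b. b \<in> B \<Longrightarrow> fst (set_reg x 0 s) b \<le> L"
    using \<open>b \<noteq> x\<close> LFor.prems by auto
  from loop[OF init] obtain t where t: "t \<le> fst s b * (T + 8) + 4"
    "exec ?w (set_reg x 0 s) t ((g ^^ fst s b) (set_reg x 0 s))" by blast
  have "exec (Assign x (Num 0)) s 2 (set_reg x 0 s)"
    using exec.Assign[of x "Num 0" "fst s" "snd s"] by (simp add: set_reg_def numeral_eq_Suc)
  from exec.Seq[OF this t(2)] have "exec (compile (LFor x b c)) s (2 + t) (run (LFor x b c) s)"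
    by (simp add: g_def)
  moreover have "2 + t \<le> poly (time (LFor x b c)) L"
  proof -
    have "fst s b * (T + 8) \<le> L * (T + 8)" using LFor.prems(2)[OF \<open>b \<in> B\<close>] by (rule mult_le_mono1)
    with t(1) have "2 + t \<le> 6 + L * (T + 8)" by linarith
    then show ?thesis by (simp add: T_def)
  qed
  ultimately show ?case by blast
qed

text \<open>The invariant is indexed by the number of finished rounds. Whatever the body does not
  write is supplied to the step for free, so an invariant has to describe only the effect of the
  loop itself.\<close>

lemma run_LFor_invariant:
  assumes x: "x \<notin> regs c"
    and init: "I 0 (set_reg x 0 s)"
    and step: "\<And>i t. i < fst s b \<Longrightarrow> I i t \<Longrightarrow> fst t x = i \<Longrightarrow>
      (\<And>y. y \<notin> insert x (regs c) \<Longrightarrow> fst t y = fst s y) \<Longrightarrow>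
      (\<And>A. A \<notin> arrays c \<Longrightarrow> snd t A = snd s A) \<Longrightarrow> I (Suc i) (set_reg x (Suc i) (run c t))"
  shows "I (fst s b) (run (LFor x b c) s)"
proof -
  have "(\<lambda>i t. I i t \<and> fst t x = i \<and> (\<forall>y. y \<notin> insert x (regs c) \<longrightarrow> fst t y = fst s y) \<and>
      (\<forall>A. A \<notin> arrays c \<longrightarrow> snd t A = snd s A)) (fst s b)
    (((\<lambda>s. set_reg x (Suc (fst s x)) (run c s)) ^^ fst s b) (set_reg x 0 s))"
  proof (rule funpow_invariant)
    fix i t
    assume "i < fst s b" and *: "I i t \<and> fst t x = i \<and>
      (\<forall>y. y \<notin> insert x (regs c) \<longrightarrow> fst t y = fst s y) \<and> (\<forall>A. A \<notin> arrays c \<longrightarrow> snd t A = snd s A)"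
    then have "I (Suc i) (set_reg x (Suc i) (run c t))" by (intro step) auto
    with * show "I (Suc i) (set_reg x (Suc (fst t x)) (run c t)) \<and>
        fst (set_reg x (Suc (fst t x)) (run c t)) x = Suc i \<and>
        (\<forall>y. y \<notin> insert x (regs c) \<longrightarrow> fst (set_reg x (Suc (fst t x)) (run c t)) y = fst s y) \<and>
        (\<forall>A. A \<notin> arrays c \<longrightarrow> snd (set_reg x (Suc (fst t x)) (run c t)) A = snd s A)"
      by (auto simp: run_frame run_frame_array)
  qed (use init in auto)
  then show ?thesis by simp
qed

declare run.simps(6) [simp del]

text \<open>Every number is charged at least its separator. This turns loop bounds, which are at
  most the input length, into a bound in terms of the bit size.\<close>

lemma length_le_bit_size: "length xs \<le> bit_size xs"
  by (induction xs) (auto simp: bit_size_def)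

section \<open>The kernelization as a loop program\<close>

text \<open>Input layout: cells 0 to 3 hold the root, \<open>k\<close> and the numbers of vertices
  and arcs; the vertices start at cell 4 and the arcs follow as pairs. Indices are doubled by
  addition because the machine does not multiply.\<close>

definition root :: exp where "root = Elem ''in'' (Num 0)"
definition vtx :: "name \<Rightarrow> exp" where "vtx i = Elem ''in'' (Plus (Num 4) (Reg i))"
definition src :: "name \<Rightarrow> exp" where
  "src j = Elem ''in'' (Plus (Plus (Num 4) (Reg ''n'')) (Plus (Reg j) (Reg j)))"
definition tgt :: "name \<Rightarrow> exp" where
  "tgt j = Elem ''in'' (Plus (Plus (Num 5) (Reg ''n'')) (Plus (Reg j) (Reg j)))"
text \<open>One of the two truncated differences is 0, so the sum is the absolute difference, which
  a test reads as inequality.\<close>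

definition neq :: "exp \<Rightarrow> exp \<Rightarrow> exp" where "neq e f = Plus (Monus e f) (Monus f e)"

lemma val_neq [simp]: "val (neq e f) s = 0 \<longleftrightarrow> val e s = val f s"
  by (auto simp: neq_def)

definition arc_test :: "name \<Rightarrow> name \<Rightarrow> name \<Rightarrow> loop" where
  "arc_test x y d = LAssign d (Num 0) ;;
     LFor ''j'' ''m'' (LCond (neq (src ''j'') (Reg x)) LSkip
       (LCond (neq (tgt ''j'') (Reg y)) LSkip (LAssign d (Num 1))))"

definition agree_test :: "name \<Rightarrow> name \<Rightarrow> name \<Rightarrow> name \<Rightarrow> loop" where
  "agree_test x y x' y' = arc_test x y ''a'' ;; arc_test x' y' ''b'' ;;
     LCond (neq (Reg ''a'') (Reg ''b'')) (LAssign ''tw'' (Num 0)) LSkip"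

definition twin_test :: loop where
  "twin_test = LAssign ''tw'' (Num 1) ;;
     LFor ''w'' ''n'' (LAssign ''z'' (vtx ''w'') ;;
       agree_test ''u'' ''z'' ''v'' ''z'' ;; agree_test ''z'' ''u'' ''z'' ''v'')"

definition increment :: "name \<Rightarrow> loop" where
  "increment x = LAssign x (Plus (Reg x) (Num 1))"

definition degree_count :: loop where
  "degree_count = LAssign ''deg'' (Num 0) ;;
     LFor ''j'' ''m'' (LCond (neq (src ''j'') (Reg ''v'')) LSkip (increment ''deg'') ;;
       LCond (neq (tgt ''j'') (Reg ''v'')) LSkip (increment ''deg''))"

definition twin_count :: loop where
  "twin_count = LAssign ''cnt'' (Num 0) ;;
     LFor ''l'' ''n'' (LAssign ''u'' (vtx ''l'') ;;
       LCond (Elem ''dead'' (Reg ''u'')) LSkip (LCond (neq (Reg ''u'') (Reg ''v''))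
         (LCond (neq (Reg ''u'') root) (twin_test ;; LCond (Reg ''tw'') (increment ''cnt'') LSkip) LSkip) LSkip))"

text \<open>The array \<open>dead\<close> is indexed by vertex names, not by positions in the list:
  any natural number is an index at unit cost, so vertices need no renumbering.\<close>

definition mark_dead :: loop where
  "mark_dead = LFor ''i'' ''n'' (LAssign ''v'' (vtx ''i'') ;;
     LCond (neq (Reg ''v'') root)
       (degree_count ;; twin_count ;;
        LCond (Monus (Reg ''cnt'') (Reg ''deg'')) (LUpdate ''dead'' (Reg ''v'') (Num 1)) LSkip) LSkip)"

definition mark_reached :: loop where
  "mark_reached = LUpdate ''reach'' root (Num 1) ;;
     LFor ''i'' ''m'' (LFor ''j'' ''m''
       (LCond (Elem ''reach'' (src ''j'')) (LUpdate ''reach'' (tgt ''j'') (Num 1)) LSkip))"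

definition find_unreached :: loop where
  "find_unreached = LAssign ''bad'' (Num 0) ;;
     LFor ''i'' ''n'' (LCond (Elem ''reach'' (vtx ''i'')) LSkip (LAssign ''bad'' (Num 1)))"

definition write_verts :: loop where
  "write_verts = LAssign ''o'' (Num 5) ;; LAssign ''cv'' (Num 0) ;;
     LFor ''i'' ''n'' (LCond (Elem ''dead'' (vtx ''i'')) LSkip
       (LUpdate ''out'' (Reg ''o'') (vtx ''i'') ;; increment ''o'' ;; increment ''cv''))"

definition write_arcs :: loop where
  "write_arcs = LAssign ''ca'' (Num 0) ;;
     LFor ''j'' ''m'' (LCond (Elem ''dead'' (src ''j'')) LSkip (LCond (Elem ''dead'' (tgt ''j'')) LSkip
       (LUpdate ''out'' (Reg ''o'') (src ''j'') ;; increment ''o'' ;;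
        LUpdate ''out'' (Reg ''o'') (tgt ''j'') ;; increment ''o'' ;; increment ''ca'')))"

text \<open>The factor is fixed for the graph class, so the product with \<open>k\<close> can be
  unrolled into an expression of constant size.\<close>

primrec times_k :: "nat \<Rightarrow> exp" where
  "times_k 0 = Num 0"
| "times_k (Suc c) = Plus (Elem ''in'' (Num 1)) (times_k c)"

definition answer :: "nat \<Rightarrow> loop" where
  "answer b = LUpdate ''out'' (Num 0) (Num b) ;; LAssign ''out'' (Num 1)"

text \<open>Written last, since the two counts are known only after both lists have been
  copied.\<close>

definition write_header :: loop where
  "write_header = LUpdate ''out'' (Num 0) (Num 2) ;; LUpdate ''out'' (Num 1) root ;;
     LUpdate ''out'' (Num 2) (Elem ''in'' (Num 1)) ;; LUpdate ''out'' (Num 3) (Reg ''cv'') ;;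
     LUpdate ''out'' (Num 4) (Reg ''ca'') ;; LAssign ''out'' (Reg ''o'')"

text \<open>All phases run unconditionally and the verdict is selected at the end. In case of a
  one-number answer the cells already written lie beyond the reported length.\<close>

definition kernelize :: "nat \<Rightarrow> loop" where
  "kernelize c = mark_reached ;; find_unreached ;; mark_dead ;; write_verts ;; write_arcs ;;
     LCond (Reg ''bad'') (answer 0)
       (LCond (Monus (Reg ''cv'') (times_k c)) (answer 1) write_header)"

text \<open>The registers \<open>n\<close> and \<open>m\<close> and the array \<open>in\<close>
  belong to none of these sets, so the input survives from phase to phase.\<close>

lemma footprint [simp]:
  "regs (arc_test x y d) = {d, ''j''}" "arrays (arc_test x y d) = {}"
  "regs (agree_test x y x' y') = {''a'', ''b'', ''j'', ''tw''}" "arrays (agree_test x y x' y') = {}"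
  "regs twin_test = {''a'', ''b'', ''j'', ''tw'', ''w'', ''z''}" "arrays twin_test = {}"
  "regs (increment x) = {x}" "arrays (increment x) = {}"
  "regs degree_count = {''j'', ''deg''}" "arrays degree_count = {}"
  "regs twin_count = {''a'', ''b'', ''j'', ''tw'', ''w'', ''z'', ''l'', ''u'', ''cnt''}" "arrays twin_count = {}"
  "regs mark_dead = {''a'', ''b'', ''j'', ''tw'', ''w'', ''z'', ''l'', ''u'', ''cnt'', ''deg'', ''v'', ''i''}"
  "arrays mark_dead = {''dead''}"
  "regs mark_reached = {''i'', ''j''}" "arrays mark_reached = {''reach''}"
  "regs find_unreached = {''i'', ''bad''}" "arrays find_unreached = {}"
  "regs write_verts = {''o'', ''cv'', ''i''}" "arrays write_verts = {''out''}"
  "regs write_arcs = {''o'', ''ca'', ''j''}" "arrays write_arcs = {''out''}"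
  by (auto simp: arc_test_def agree_test_def twin_test_def increment_def degree_count_def
      twin_count_def mark_dead_def mark_reached_def find_unreached_def write_verts_def write_arcs_def)

lemma bounded_by_kernelize: "bounded_by {''n'', ''m''} (kernelize c)"
  by (simp add: kernelize_def arc_test_def agree_test_def twin_test_def increment_def
      degree_count_def twin_count_def mark_dead_def mark_reached_def find_unreached_def
      write_verts_def write_arcs_def answer_def write_header_def)

lemma run_increment [simp]: "run (increment x) s = set_reg x (Suc (fst s x)) s"
  by (simp add: increment_def)

section \<open>Correctness of the program on encoded instances\<close>

definition iob_code :: "nat list \<Rightarrow> (nat \<times> nat) list \<Rightarrow> nat \<Rightarrow> nat \<Rightarrow> nat list" where
  "iob_code vs es r k = [r, k, length vs, length es] @ vs @ concat (map (\<lambda>(u, v). [u, v]) es)"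

lemma nth_concat_pairs:
  assumes "j < length es"
  shows "concat (map (\<lambda>(u, v). [u, v]) es) ! (j + j) = fst (es ! j)"
    "concat (map (\<lambda>(u, v). [u, v]) es) ! Suc (j + j) = snd (es ! j)"
  using assms
proof (induction es arbitrary: j)
  case (Cons e es)
  case 1
  then show ?case using Cons.IH(1) by (cases e; cases j) auto
  case 2
  then show ?case using Cons.IH(2) by (cases e; cases j) auto
qed auto

lemma length_concat_pairs: "length (concat (map (\<lambda>(u, v). [u, v]) es)) = length es + length es"
  by (induction es) auto

locale iob_input =
  fixes vs :: "nat list" and es :: "(nat \<times> nat) list" and r k :: nat
  assumes distinct_vs: "distinct vs" and distinct_es: "distinct es"
    and es_subset: "set es \<subseteq> set vs \<times> set vs" and root_in_vs: "r \<in> set vs"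
begin

definition inp :: "state \<Rightarrow> bool" where
  "inp s \<longleftrightarrow> fst s ''n'' = length vs \<and> fst s ''m'' = length es \<and>
     snd s ''in'' = (\<lambda>i. if i < length (iob_code vs es r k) then iob_code vs es r k ! i else 0)"

lemma inp_root [simp]: "inp s \<Longrightarrow> val root s = r"
  by (simp add: inp_def root_def iob_code_def)

lemma inp_k [simp]: "inp s \<Longrightarrow> snd s ''in'' (Suc 0) = k"
  by (simp add: inp_def iob_code_def)

lemma inp_vtx [simp]: "inp s \<Longrightarrow> fst s i < length vs \<Longrightarrow> val (vtx i) s = vs ! fst s i"
  by (simp add: inp_def vtx_def iob_code_def nth_append)

lemma inp_src [simp]: "inp s \<Longrightarrow> fst s j < length es \<Longrightarrow> val (src j) s = fst (es ! fst s j)"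
  by (simp add: inp_def src_def iob_code_def nth_append length_concat_pairs nth_concat_pairs[folded mult_2])

lemma inp_tgt [simp]: "inp s \<Longrightarrow> fst s j < length es \<Longrightarrow> val (tgt j) s = snd (es ! fst s j)"
  by (simp add: inp_def tgt_def iob_code_def nth_append length_concat_pairs nth_concat_pairs[folded mult_2])

lemma inp_set_reg [simp]: "x \<noteq> ''n'' \<Longrightarrow> x \<noteq> ''m'' \<Longrightarrow> inp (set_reg x v s) = inp s"
  by (simp add: inp_def)

lemma inp_set_elem [simp]: "A \<noteq> ''in'' \<Longrightarrow> inp (set_elem A i v s) = inp s"
  by (simp add: inp_def)

lemma inp_run: "inp s \<Longrightarrow> ''n'' \<notin> regs c \<Longrightarrow> ''m'' \<notin> regs c \<Longrightarrow> ''in'' \<notin> arrays c \<Longrightarrow> inp (run c s)"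
  by (simp add: inp_def run_frame run_frame_array)

lemma inp_frame:
  "inp s \<Longrightarrow> fst t ''n'' = fst s ''n'' \<Longrightarrow> fst t ''m'' = fst s ''m'' \<Longrightarrow> snd t ''in'' = snd s ''in'' \<Longrightarrow> inp t"
  by (simp add: inp_def)

lemma set_take_Suc: "i < length xs \<Longrightarrow> set (take (Suc i) xs) = insert (xs ! i) (set (take i xs))"
  by (simp add: take_Suc_conv_app_nth)

lemma arc_test:
  assumes s: "inp s" and d: "d \<notin> {''j'', ''n'', ''m''}" and xy: "x \<notin> {d, ''j''}" "y \<notin> {d, ''j''}"
  shows "fst (run (arc_test x y d) s) d = of_bool ((fst s x, fst s y) \<in> set es)"
proof -
  define s' where "s' = set_reg d 0 s"
  define c where "c = LCond (neq (src ''j'') (Reg x)) LSkip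
    (LCond (neq (tgt ''j'') (Reg y)) LSkip (LAssign d (Num 1)))"
  have m: "fst s' ''m'' = length es" using s d by (auto simp: s'_def inp_def)
  have "(\<lambda>i t. fst t d = of_bool ((fst s x, fst s y) \<in> set (take i es)))
      (fst s' ''m'') (run (LFor ''j'' ''m'' c) s')"
  proof (rule run_LFor_invariant)
    fix i t
    assume i: "i < fst s' ''m''" and I: "fst t d = of_bool ((fst s x, fst s y) \<in> set (take i es))"
      and j: "fst t ''j'' = i"
      and fr: "\<And>z. z \<notin> insert ''j'' (regs c) \<Longrightarrow> fst t z = fst s' z"
      "\<And>A. A \<notin> arrays c \<Longrightarrow> snd t A = snd s' A"
    have "inp s'" using s d by (simp add: s'_def)
    then have t: "inp t" by (rule inp_frame) (use fr d in \<open>auto simp: c_def\<close>)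
    have xy': "fst t x = fst s x" "fst t y = fst s y"
      using fr(1)[of x] fr(1)[of y] xy d by (auto simp: c_def s'_def)
    show "fst (set_reg ''j'' (Suc i) (run c t)) d = of_bool ((fst s x, fst s y) \<in> set (take (Suc i) es))"
      using i m j t I d xy' by (auto simp: c_def set_take_Suc prod_eq_iff)
  qed (use d in \<open>auto simp: c_def s'_def\<close>)
  then show ?thesis by (simp add: arc_test_def c_def m flip: s'_def)
qed

lemma agree_test:
  assumes s: "inp s" and xy: "{x, y, x', y'} \<inter> {''a'', ''b'', ''j'', ''tw''} = {}"
  shows "fst (run (agree_test x y x' y') s) ''tw'' =
    (if ((fst s x, fst s y) \<in> set es) = ((fst s x', fst s y') \<in> set es) then fst s ''tw'' else 0)"
proof -
  define s1 where "s1 = run (arc_test x y ''a'') s"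
  define s2 where "s2 = run (arc_test x' y' ''b'') s1"
  have s1: "inp s1" unfolding s1_def by (rule inp_run[OF s]) auto
  have "fst s1 ''a'' = of_bool ((fst s x, fst s y) \<in> set es)"
    unfolding s1_def by (rule arc_test[OF s]) (use xy in auto)
  then have a: "fst s2 ''a'' = of_bool ((fst s x, fst s y) \<in> set es)"
    unfolding s2_def by (subst run_frame) auto
  have "fst s1 x' = fst s x'" "fst s1 y' = fst s y'"
    unfolding s1_def by (rule run_frame; use xy in auto)+
  then have b: "fst s2 ''b'' = of_bool ((fst s x', fst s y') \<in> set es)"
    unfolding s2_def using xy by (subst arc_test[OF s1]) auto
  have tw: "fst s2 ''tw'' = fst s ''tw''"
    unfolding s2_def s1_def by (simp add: run_frame)
  show ?thesis
    by (simp add: agree_test_def a b tw flip: s1_def s2_def)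
qed

abbreviation "E \<equiv> set es"

lemma twin_test:
  assumes s: "inp s"
  shows "fst (run twin_test s) ''tw'' = of_bool (twins E (fst s ''u'') (fst s ''v''))"
proof -
  define s' where "s' = set_reg ''tw'' (Suc 0) s"
  define c where "c = LAssign ''z'' (vtx ''w'') ;;
       agree_test ''u'' ''z'' ''v'' ''z'' ;; agree_test ''z'' ''u'' ''z'' ''v''"
  define same where "same z \<longleftrightarrow> ((fst s ''u'', z) \<in> E) = ((fst s ''v'', z) \<in> E) \<and>
      ((z, fst s ''u'') \<in> E) = ((z, fst s ''v'') \<in> E)" for z
  have n: "fst s' ''n'' = length vs" using s by (simp add: s'_def inp_def)
  have "(\<lambda>i t. fst t ''tw'' = of_bool (\<forall>z\<in>set (take i vs). same z))
      (fst s' ''n'') (run (LFor ''w'' ''n'' c) s')"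
  proof (rule run_LFor_invariant)
    fix i t
    assume i: "i < fst s' ''n''" and I: "fst t ''tw'' = of_bool (\<forall>z\<in>set (take i vs). same z)"
      and w: "fst t ''w'' = i"
      and fr: "\<And>z. z \<notin> insert ''w'' (regs c) \<Longrightarrow> fst t z = fst s' z"
      "\<And>A. A \<notin> arrays c \<Longrightarrow> snd t A = snd s' A"
    have "inp s'" using s by (simp add: s'_def)
    then have t: "inp t" by (rule inp_frame) (use fr in \<open>auto simp: c_def\<close>)
    have uv: "fst t ''u'' = fst s ''u''" "fst t ''v'' = fst s ''v''"
      using fr(1)[of "''u''"] fr(1)[of "''v''"] by (auto simp: c_def s'_def)
    define t1 where "t1 = set_reg ''z'' (vs ! i) t"
    define t2 where "t2 = run (agree_test ''u'' ''z'' ''v'' ''z'') t1"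
    have t1: "inp t1" using t by (simp add: t1_def)
    have t2: "inp t2" unfolding t2_def by (rule inp_run[OF t1]) auto
    have z: "fst t2 ''z'' = vs ! i" "fst t2 ''u'' = fst s ''u''" "fst t2 ''v'' = fst s ''v''"
      unfolding t2_def by (simp_all add: run_frame t1_def uv)
    have "fst t2 ''tw'' = (if ((fst s ''u'', vs ! i) \<in> E) = ((fst s ''v'', vs ! i) \<in> E)
        then fst t ''tw'' else 0)"
      unfolding t2_def by (subst agree_test[OF t1]) (simp_all add: t1_def uv)
    then have "fst (run (agree_test ''z'' ''u'' ''z'' ''v'') t2) ''tw'' =
        (if same (vs ! i) then fst t ''tw'' else 0)"
      by (subst agree_test[OF t2]) (auto simp: z same_def)
    moreover have "run c t = run (agree_test ''z'' ''u'' ''z'' ''v'') t2"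
      using t w i n by (simp add: c_def t2_def t1_def)
    ultimately show "fst (set_reg ''w'' (Suc i) (run c t)) ''tw'' =
        of_bool (\<forall>z\<in>set (take (Suc i) vs). same z)"
      using i n I by (simp add: set_take_Suc)
  qed (auto simp: c_def s'_def)
  \<comment> \<open>Arcs have both ends in \<open>vs\<close>, so agreement on the listed vertices is
    agreement of the entire neighbourhoods.\<close>
  moreover have "(\<forall>z\<in>set vs. same z) \<longleftrightarrow> twins E (fst s ''u'') (fst s ''v'')"
    using es_subset unfolding twins_def same_def by blast
  ultimately show ?thesis by (simp add: twin_test_def c_def n flip: s'_def)
qed

lemma degree_count:
  assumes s: "inp s"
  shows "fst (run degree_count s) ''deg'' = total_degree E (fst s ''v'')"
proof -
  define s' where "s' = set_reg ''deg'' 0 s"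
  define c where "c = (LCond (neq (src ''j'') (Reg ''v'')) LSkip (increment ''deg'') ;;
       LCond (neq (tgt ''j'') (Reg ''v'')) LSkip (increment ''deg''))"
  define v where "v = fst s ''v''"
  have m: "fst s' ''m'' = length es" using s by (simp add: s'_def inp_def)
  have "(\<lambda>i t. fst t ''deg'' = length (filter (\<lambda>e. fst e = v) (take i es)) +
        length (filter (\<lambda>e. snd e = v) (take i es)))
      (fst s' ''m'') (run (LFor ''j'' ''m'' c) s')"
  proof (rule run_LFor_invariant)
    fix i t
    assume i: "i < fst s' ''m''" and I: "fst t ''deg'' = length (filter (\<lambda>e. fst e = v) (take i es)) +
        length (filter (\<lambda>e. snd e = v) (take i es))"
      and j: "fst t ''j'' = i"
      and fr: "\<And>z. z \<notin> insert ''j'' (regs c) \<Longrightarrow> fst t z = fst s' z"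
      "\<And>A. A \<notin> arrays c \<Longrightarrow> snd t A = snd s' A"
    have "inp s'" using s by (simp add: s'_def)
    then have t: "inp t" by (rule inp_frame) (use fr in \<open>auto simp: c_def\<close>)
    have "fst t ''v'' = v" using fr(1)[of "''v''"] by (auto simp: c_def s'_def v_def)
    then show "fst (set_reg ''j'' (Suc i) (run c t)) ''deg'' =
        length (filter (\<lambda>e. fst e = v) (take (Suc i) es)) +
        length (filter (\<lambda>e. snd e = v) (take (Suc i) es))"
      using i m j t I by (simp add: c_def take_Suc_conv_app_nth)
  qed (auto simp: c_def s'_def)
  then have deg: "fst (run degree_count s) ''deg'' = length (filter (\<lambda>e. fst e = v) es) +
        length (filter (\<lambda>e. snd e = v) es)"
    by (simp add: degree_count_def c_def m flip: s'_def)
  \<comment> \<open>Arcs are listed without repetition, so counting list entries counts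
    neighbours.\<close>
  have "length (filter (\<lambda>e. fst e = v) es) = card {e \<in> E. fst e = v}"
    using distinct_es by (simp add: distinct_length_filter Int_def conj_commute)
  also have "\<dots> = card (E `` {v})"
    by (rule bij_betw_same_card[of snd]) (force simp: bij_betw_def inj_on_def)
  finally have out: "length (filter (\<lambda>e. fst e = v) es) = card (E `` {v})" .
  have "length (filter (\<lambda>e. snd e = v) es) = card {e \<in> E. snd e = v}"
    using distinct_es by (simp add: distinct_length_filter Int_def conj_commute)
  also have "\<dots> = card (E\<inverse> `` {v})"
    by (rule bij_betw_same_card[of fst]) (force simp: bij_betw_def inj_on_def)
  finally show ?thesis using deg out by (simp add: total_degree_def v_def)
qed

lemma twin_count:
  assumes s: "inp s"
  shows "fst (run twin_count s) ''cnt'' = card {u \<in> set vs. snd s ''dead'' u = 0 \<and>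
    u \<noteq> fst s ''v'' \<and> u \<noteq> r \<and> twins E u (fst s ''v'')}"
proof -
  define s' where "s' = set_reg ''cnt'' 0 s"
  define c where "c = LAssign ''u'' (vtx ''l'') ;;
       LCond (Elem ''dead'' (Reg ''u'')) LSkip (LCond (neq (Reg ''u'') (Reg ''v''))
         (LCond (neq (Reg ''u'') root) (twin_test ;; LCond (Reg ''tw'') (increment ''cnt'') LSkip) LSkip) LSkip)"
  define v where "v = fst s ''v''"
  define P where "P u \<longleftrightarrow> snd s ''dead'' u = 0 \<and> u \<noteq> v \<and> u \<noteq> r \<and> twins E u v" for u
  have n: "fst s' ''n'' = length vs" using s by (simp add: s'_def inp_def)
  have "(\<lambda>i t. fst t ''cnt'' = length (filter P (take i vs)))
      (fst s' ''n'') (run (LFor ''l'' ''n'' c) s')"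
  proof (rule run_LFor_invariant)
    fix i t
    assume i: "i < fst s' ''n''" and I: "fst t ''cnt'' = length (filter P (take i vs))"
      and l: "fst t ''l'' = i"
      and fr: "\<And>z. z \<notin> insert ''l'' (regs c) \<Longrightarrow> fst t z = fst s' z"
      "\<And>A. A \<notin> arrays c \<Longrightarrow> snd t A = snd s' A"
    have "inp s'" using s by (simp add: s'_def)
    then have t: "inp t" by (rule inp_frame) (use fr in \<open>auto simp: c_def\<close>)
    define t1 where "t1 = set_reg ''u'' (vs ! i) t"
    have t1: "inp t1" using t by (simp add: t1_def)
    have v1: "fst t1 ''v'' = v" "fst t1 ''u'' = vs ! i" "snd t1 ''dead'' = snd s ''dead''"
      using fr(1)[of "''v''"] fr(2)[of "''dead''"] by (simp_all add: c_def s'_def v_def t1_def)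
    have tw: "fst (run twin_test t1) ''tw'' = of_bool (twins E (vs ! i) v)"
      "fst (run twin_test t1) ''cnt'' = fst t ''cnt''"
      using twin_test[OF t1] by (simp_all add: v1 run_frame) (simp add: t1_def)
    have "fst (run c t) ''cnt'' = fst t ''cnt'' + of_bool (P (vs ! i))"
    proof -
      have "run (LAssign ''u'' (vtx ''l'')) t = t1"
        using t l i n by (simp add: t1_def)
      moreover have "fst t1 ''cnt'' = fst t ''cnt''" by (simp add: t1_def)
      ultimately show ?thesis using t1 v1 tw by (simp add: c_def P_def)
    qed
    then show "fst (set_reg ''l'' (Suc i) (run c t)) ''cnt'' = length (filter P (take (Suc i) vs))"
      using i n I by (simp add: take_Suc_conv_app_nth)
  qed (auto simp: c_def s'_def)
  then have "fst (run twin_count s) ''cnt'' = length (filter P vs)"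
    by (simp add: twin_count_def c_def n flip: s'_def)
  also have "\<dots> = card {u \<in> set vs. P u}"
    using distinct_vs by (simp add: distinct_length_filter Int_def conj_commute)
  finally show ?thesis by (simp add: P_def v_def)
qed

lemma mark_dead:
  assumes s: "inp s" and alive: "snd s ''dead'' = (\<lambda>_. 0)" and x: "x \<in> set vs"
  shows "snd (run mark_dead s) ''dead'' x = 0 \<longleftrightarrow> x \<in> delete_twins E r vs"
proof -
  define c where "c = (LAssign ''v'' (vtx ''i'') ;;
     LCond (neq (Reg ''v'') root)
       (degree_count ;; twin_count ;;
        LCond (Monus (Reg ''cnt'') (Reg ''deg'')) (LUpdate ''dead'' (Reg ''v'') (Num 1)) LSkip) LSkip)"
  \<comment> \<open>The vertices left after \<open>i\<close> steps of the pass; the nonzero cells of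
    \<open>dead\<close> mark the complement within \<open>vs\<close>.\<close>
  define A where "A i = foldl (delete_twin E r) (set vs) (take i vs)" for i
  have n: "fst s ''n'' = length vs" using s by (simp add: inp_def)
  have "(\<lambda>i t. \<forall>x\<in>set vs. snd t ''dead'' x = 0 \<longleftrightarrow> x \<in> A i)
      (fst s ''n'') (run (LFor ''i'' ''n'' c) s)"
  proof (rule run_LFor_invariant)
    fix i t
    assume i: "i < fst s ''n''" and I: "\<forall>x\<in>set vs. snd t ''dead'' x = 0 \<longleftrightarrow> x \<in> A i"
      and ii: "fst t ''i'' = i"
      and fr: "\<And>z. z \<notin> insert ''i'' (regs c) \<Longrightarrow> fst t z = fst s z"
      "\<And>A. A \<notin> arrays c \<Longrightarrow> snd t A = snd s A"
    have t: "inp t" using s by (rule inp_frame) (use fr in \<open>auto simp: c_def\<close>)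
    define v where "v = vs ! i"
    have v: "v \<in> set vs" using i n by (simp add: v_def)
    have AS: "A (Suc i) = delete_twin E r (A i) v"
      using i n by (simp add: A_def v_def take_Suc_conv_app_nth)
    have Avs: "A i \<subseteq> set vs" unfolding A_def by (rule foldl_delete_twin_subset)
    define t1 where "t1 = set_reg ''v'' v t"
    define t2 where "t2 = run degree_count t1"
    define t3 where "t3 = run twin_count t2"
    have t1: "inp t1" using t by (simp add: t1_def)
    have t2: "inp t2" unfolding t2_def by (rule inp_run[OF t1]) auto
    have v1: "fst t1 ''v'' = v" by (simp add: t1_def)
    have v2: "fst t2 ''v'' = v" "snd t2 ''dead'' = snd t ''dead''"
      by (simp_all add: t2_def run_frame run_frame_array) (simp_all add: t1_def)
    have v3: "fst t3 ''v'' = v" "snd t3 ''dead'' = snd t ''dead''" "fst t3 ''deg'' = total_degree E v"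
      using v2 degree_count[OF t1] by (simp_all add: t3_def run_frame run_frame_array v1 t2_def)
    have "{u \<in> set vs. snd t ''dead'' u = 0 \<and> u \<noteq> v \<and> u \<noteq> r \<and> twins E u v}
        = {u \<in> A i - {r, v}. twins E u v}"
      using I Avs by auto
    then have cnt: "fst t3 ''cnt'' = card {u \<in> A i - {r, v}. twins E u v}"
      using twin_count[OF t2] v2 by (simp add: t3_def)
    have run: "run c t = (if v \<noteq> r then
        if total_degree E v < card {u \<in> A i - {r, v}. twins E u v} then set_elem ''dead'' v 1 t3 else t3
        else t1)"
    proof -
      have "run (LAssign ''v'' (vtx ''i'')) t = t1" using t i n ii by (simp add: t1_def v_def)
      then have "run c t = run (LCond (neq (Reg ''v'') root)
       (degree_count ;; twin_count ;;
        LCond (Monus (Reg ''cnt'') (Reg ''deg'')) (LUpdate ''dead'' (Reg ''v'') (Num 1)) LSkip) LSkip) t1"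
        by (simp only: c_def run.simps)
      then show ?thesis using t1 v1 v3 cnt by (simp flip: t2_def t3_def)
    qed
    have "snd t1 ''dead'' = snd t ''dead''" by (simp add: t1_def)
    with run v3(2) have "snd (run c t) ''dead'' = (if v \<noteq> r \<and>
        total_degree E v < card {u \<in> A i - {r, v}. twins E u v}
        then (snd t ''dead'')(v := 1) else snd t ''dead'')"
      by auto
    then show "\<forall>x\<in>set vs. snd (set_reg ''i'' (Suc i) (run c t)) ''dead'' x = 0 \<longleftrightarrow> x \<in> A (Suc i)"
      using I by (auto simp: AS delete_twin_def)
  qed (use alive in \<open>auto simp: c_def A_def\<close>)
  then show ?thesis using x by (simp add: mark_dead_def c_def n A_def delete_twins_def)
qed

text \<open>After \<open>i\<close> rounds all vertices at distance at most \<open>i\<close> from the root are marked. As the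
  reachability relation is exhausted by paths with at most \<^term>\<open>card E\<close> arcs, that many rounds
  suffice.\<close>

lemma mark_reached:
  assumes s: "inp s" and fresh: "snd s ''reach'' = (\<lambda>_. 0)"
  shows "snd (run mark_reached s) ''reach'' x \<noteq> 0 \<longleftrightarrow> (r, x) \<in> E\<^sup>*"
proof -
  define s' where "s' = set_elem ''reach'' r (Suc 0) s"
  define b where "b = LCond (Elem ''reach'' (src ''j'')) (LUpdate ''reach'' (tgt ''j'') (Num 1)) LSkip"
  define c where "c = LFor ''j'' ''m'' b"
  define M where "M t = {x. snd t ''reach'' x \<noteq> 0}" for t :: state
  have m: "fst s' ''m'' = length es" using s by (simp add: s'_def inp_def)
  have s': "inp s'" using s by (simp add: s'_def)
  have root: "run (LUpdate ''reach'' root (Num 1)) s = s'" using s by (simp add: s'_def)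
  have "(\<lambda>i t. M t \<subseteq> E\<^sup>* `` {r} \<and> (\<forall>l\<le>i. (E ^^ l) `` {r} \<subseteq> M t)) (fst s' ''m'') (run (LFor ''i'' ''m'' c) s')"
  proof (rule run_LFor_invariant)
    fix i t
    assume i: "i < fst s' ''m''" and I: "M t \<subseteq> E\<^sup>* `` {r} \<and> (\<forall>l\<le>i. (E ^^ l) `` {r} \<subseteq> M t)"
      and fr: "\<And>z. z \<notin> insert ''i'' (regs c) \<Longrightarrow> fst t z = fst s' z"
      "\<And>A. A \<notin> arrays c \<Longrightarrow> snd t A = snd s' A"
    have t: "inp t" using s' by (rule inp_frame) (use fr in \<open>auto simp: b_def c_def\<close>)
    have mt: "fst t ''m'' = length es" using t by (simp add: inp_def)
    \<comment> \<open>A mark set in this round may propagate further within the same round, so the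
      marked set need not be a ball around the root. The lower bound therefore uses only the marks
      \<open>M t\<close> from the start of the round, and the upper bound only reachability.\<close>
    have "(\<lambda>j u. M u \<subseteq> E\<^sup>* `` {r} \<and> M t \<subseteq> M u \<and> (\<forall>e\<in>set (take j es). fst e \<in> M t \<longrightarrow> snd e \<in> M u))
      (fst t ''m'') (run (LFor ''j'' ''m'' b) t)"
    proof (rule run_LFor_invariant)
      fix j u
      assume j: "j < fst t ''m''" and J: "M u \<subseteq> E\<^sup>* `` {r} \<and> M t \<subseteq> M u \<and>
          (\<forall>e\<in>set (take j es). fst e \<in> M t \<longrightarrow> snd e \<in> M u)"
        and jj: "fst u ''j'' = j"
        and fr: "\<And>z. z \<notin> insert ''j'' (regs b) \<Longrightarrow> fst u z = fst t z"
        "\<And>A. A \<notin> arrays b \<Longrightarrow> snd u A = snd t A"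
      have u: "inp u" using t by (rule inp_frame) (use fr in \<open>auto simp: b_def\<close>)
      have e: "es ! j \<in> E" using j mt by simp
      have run: "M (set_reg ''j'' (Suc j) (run b u)) =
          (if fst (es ! j) \<in> M u then insert (snd (es ! j)) (M u) else M u)"
        using u j jj mt by (auto simp: b_def M_def)
      have "snd (es ! j) \<in> E\<^sup>* `` {r}" if "fst (es ! j) \<in> M u"
      proof -
        have "(r, fst (es ! j)) \<in> E\<^sup>*" using that J by auto
        then show ?thesis using e by (metis Image_singleton_iff prod.collapse rtrancl.rtrancl_into_rtrancl)
      qed
      then show "M (set_reg ''j'' (Suc j) (run b u)) \<subseteq> E\<^sup>* `` {r} \<and>
          M t \<subseteq> M (set_reg ''j'' (Suc j) (run b u)) \<and>
          (\<forall>e\<in>set (take (Suc j) es). fst e \<in> M t \<longrightarrow> snd e \<in> M (set_reg ''j'' (Suc j) (run b u)))"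
        using J j mt unfolding run by (auto simp: set_take_Suc)
    qed (use I in \<open>auto simp: b_def M_def\<close>)
    then have J: "M (run c t) \<subseteq> E\<^sup>* `` {r}" "M t \<subseteq> M (run c t)"
      "\<And>e. e \<in> E \<Longrightarrow> fst e \<in> M t \<Longrightarrow> snd e \<in> M (run c t)"
      by (auto simp: c_def mt)
    have "(E ^^ l) `` {r} \<subseteq> M (run c t)" if l: "l \<le> Suc i" for l
    proof (cases "l \<le> i")
      case True
      then show ?thesis using I J(2) by blast
    next
      case False
      with l have l: "l = Suc i" by simp
      show ?thesis
      proof
        fix y assume "y \<in> (E ^^ l) `` {r}"
        then obtain x where x: "(r, x) \<in> E ^^ i" "(x, y) \<in> E" unfolding l by auto
        with I have "x \<in> M t" by blast
        with J(3)[OF x(2)] show "y \<in> M (run c t)" by simp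
      qed
    qed
    moreover have "M (set_reg ''i'' (Suc i) (run c t)) = M (run c t)" by (simp add: M_def)
    ultimately show "M (set_reg ''i'' (Suc i) (run c t)) \<subseteq> E\<^sup>* `` {r} \<and>
        (\<forall>l\<le>Suc i. (E ^^ l) `` {r} \<subseteq> M (set_reg ''i'' (Suc i) (run c t)))"
      using J(1) by simp
  next
    show "M (set_reg ''i'' 0 s') \<subseteq> E\<^sup>* `` {r} \<and> (\<forall>l\<le>0. (E ^^ l) `` {r} \<subseteq> M (set_reg ''i'' 0 s'))"
      by (auto simp: M_def s'_def fresh)
  qed (auto simp: b_def c_def)
  then have M: "M (run mark_reached s) \<subseteq> E\<^sup>* `` {r}" "\<And>l. l \<le> length es \<Longrightarrow> (E ^^ l) `` {r} \<subseteq> M (run mark_reached s)"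
    unfolding mark_reached_def run.simps(4) root by (auto simp: b_def c_def m)
  have "E\<^sup>* `` {r} \<subseteq> M (run mark_reached s)"
  proof
    fix y assume "y \<in> E\<^sup>* `` {r}"
    then obtain l where "l \<le> card E" "(r, y) \<in> E ^^ l"
      by (auto simp: rtrancl_finite_eq_relpow)
    with M(2)[of l] show "y \<in> M (run mark_reached s)"
      using distinct_es by (auto simp: distinct_card)
  qed
  with M(1) show ?thesis by (auto simp: M_def)
qed

lemma find_unreached:
  assumes s: "inp s"
  shows "fst (run find_unreached s) ''bad'' = of_bool (\<exists>x\<in>set vs. snd s ''reach'' x = 0)"
proof -
  define s' where "s' = set_reg ''bad'' 0 s"
  define c where "c = LCond (Elem ''reach'' (vtx ''i'')) LSkip (LAssign ''bad'' (Num 1))"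
  have n: "fst s' ''n'' = length vs" using s by (simp add: s'_def inp_def)
  have "(\<lambda>i t. fst t ''bad'' = of_bool (\<exists>x\<in>set (take i vs). snd s ''reach'' x = 0))
      (fst s' ''n'') (run (LFor ''i'' ''n'' c) s')"
  proof (rule run_LFor_invariant)
    fix i t
    assume i: "i < fst s' ''n''" and I: "fst t ''bad'' = of_bool (\<exists>x\<in>set (take i vs). snd s ''reach'' x = 0)"
      and ii: "fst t ''i'' = i"
      and fr: "\<And>z. z \<notin> insert ''i'' (regs c) \<Longrightarrow> fst t z = fst s' z"
      "\<And>A. A \<notin> arrays c \<Longrightarrow> snd t A = snd s' A"
    have "inp s'" using s by (simp add: s'_def)
    then have t: "inp t" by (rule inp_frame) (use fr in \<open>auto simp: c_def\<close>)
    have "snd t ''reach'' = snd s ''reach''" using fr(2)[of "''reach''"] by (simp add: c_def s'_def)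
    then show "fst (set_reg ''i'' (Suc i) (run c t)) ''bad'' =
        of_bool (\<exists>x\<in>set (take (Suc i) vs). snd s ''reach'' x = 0)"
      using i n ii t I by (auto simp: c_def set_take_Suc)
  qed (auto simp: c_def s'_def)
  then show ?thesis by (simp add: find_unreached_def c_def n flip: s'_def)
qed

text \<open>Cells 0 to 4 of the output are reserved for the verdict and the four header numbers.\<close>

definition out_list :: "state \<Rightarrow> nat list \<Rightarrow> bool" where
  "out_list s xs \<longleftrightarrow> fst s ''o'' = 5 + length xs \<and> map (snd s ''out'') [5..<5 + length xs] = xs"

lemma out_list_append:
  assumes "out_list s xs" "fst t ''o'' = Suc (fst s ''o'')"
    "snd t ''out'' = (snd s ''out'')(fst s ''o'' := x)"
  shows "out_list t (xs @ [x])"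
proof -
  have "map ((snd s ''out'')(5 + length xs := x)) [5..<5 + length xs] = map (snd s ''out'') [5..<5 + length xs]"
    by (intro map_cong) auto
  moreover have "[5..<6 + length xs] = [5..<5 + length xs] @ [5 + length xs]"
    using upt_Suc_append[of 5 "5 + length xs"] by simp
  ultimately show ?thesis using assms by (simp add: out_list_def)
qed

lemma write_verts:
  assumes s: "inp s"
  shows "out_list (run write_verts s) (filter (\<lambda>x. snd s ''dead'' x = 0) vs)"
    "fst (run write_verts s) ''cv'' = length (filter (\<lambda>x. snd s ''dead'' x = 0) vs)"
proof -
  define s' where "s' = set_reg ''cv'' 0 (set_reg ''o'' 5 s)"
  define c where "c = LCond (Elem ''dead'' (vtx ''i'')) LSkip
       (LUpdate ''out'' (Reg ''o'') (vtx ''i'') ;; increment ''o'' ;; increment ''cv'')"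
  have n: "fst s' ''n'' = length vs" using s by (simp add: s'_def inp_def)
  have "(\<lambda>i t. out_list t (filter (\<lambda>x. snd s ''dead'' x = 0) (take i vs)) \<and>
        fst t ''cv'' = length (filter (\<lambda>x. snd s ''dead'' x = 0) (take i vs)))
      (fst s' ''n'') (run (LFor ''i'' ''n'' c) s')"
  proof (rule run_LFor_invariant)
    fix i t
    assume i: "i < fst s' ''n''" and I: "out_list t (filter (\<lambda>x. snd s ''dead'' x = 0) (take i vs)) \<and>
        fst t ''cv'' = length (filter (\<lambda>x. snd s ''dead'' x = 0) (take i vs))"
      and ii: "fst t ''i'' = i"
      and fr: "\<And>z. z \<notin> insert ''i'' (regs c) \<Longrightarrow> fst t z = fst s' z"
      "\<And>A. A \<notin> arrays c \<Longrightarrow> snd t A = snd s' A"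
    have "inp s'" using s by (simp add: s'_def)
    then have t: "inp t" by (rule inp_frame) (use fr in \<open>auto simp: c_def\<close>)
    have dead: "snd t ''dead'' = snd s ''dead''" using fr(2)[of "''dead''"] by (simp add: c_def s'_def)
    let ?t = "set_reg ''i'' (Suc i) (run c t)"
    show "out_list ?t (filter (\<lambda>x. snd s ''dead'' x = 0) (take (Suc i) vs)) \<and>
        fst ?t ''cv'' = length (filter (\<lambda>x. snd s ''dead'' x = 0) (take (Suc i) vs))"
    proof (cases "snd s ''dead'' (vs ! i) = 0")
      case True
      have "out_list ?t (filter (\<lambda>x. snd s ''dead'' x = 0) (take i vs) @ [vs ! i])"
        by (rule out_list_append[of t]) (use I True dead t i ii n in \<open>simp_all add: c_def\<close>)
      then show ?thesis using I True dead t i ii n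
        by (simp add: c_def take_Suc_conv_app_nth)
    next
      case False
      then show ?thesis using I dead t i ii n
        by (simp add: c_def take_Suc_conv_app_nth out_list_def)
    qed
  qed (auto simp: c_def s'_def out_list_def)
  then show "out_list (run write_verts s) (filter (\<lambda>x. snd s ''dead'' x = 0) vs)"
    "fst (run write_verts s) ''cv'' = length (filter (\<lambda>x. snd s ''dead'' x = 0) vs)"
    by (simp_all add: write_verts_def c_def n flip: s'_def)
qed

lemma write_arcs:
  fixes s
  defines "P \<equiv> \<lambda>e. snd s ''dead'' (fst e) = 0 \<and> snd s ''dead'' (snd e) = 0"
  assumes s: "inp s" and out: "out_list s xs"
  shows "out_list (run write_arcs s) (xs @ concat (map (\<lambda>(u, v). [u, v]) (filter P es)))"
    "fst (run write_arcs s) ''ca'' = length (filter P es)"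
proof -
  define s' where "s' = set_reg ''ca'' 0 s"
  define c where "c = LCond (Elem ''dead'' (src ''j'')) LSkip (LCond (Elem ''dead'' (tgt ''j'')) LSkip
       (LUpdate ''out'' (Reg ''o'') (src ''j'') ;; increment ''o'' ;;
        LUpdate ''out'' (Reg ''o'') (tgt ''j'') ;; increment ''o'' ;; increment ''ca''))"
  define L where "L j = xs @ concat (map (\<lambda>(u, v). [u, v]) (filter P (take j es)))" for j
  have m: "fst s' ''m'' = length es" using s by (simp add: s'_def inp_def)
  have "(\<lambda>j t. out_list t (L j) \<and> fst t ''ca'' = length (filter P (take j es)))
      (fst s' ''m'') (run (LFor ''j'' ''m'' c) s')"
  proof (rule run_LFor_invariant)
    fix j t
    assume j: "j < fst s' ''m''" and I: "out_list t (L j) \<and> fst t ''ca'' = length (filter P (take j es))"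
      and jj: "fst t ''j'' = j"
      and fr: "\<And>z. z \<notin> insert ''j'' (regs c) \<Longrightarrow> fst t z = fst s' z"
      "\<And>A. A \<notin> arrays c \<Longrightarrow> snd t A = snd s' A"
    have "inp s'" using s by (simp add: s'_def)
    then have t: "inp t" by (rule inp_frame) (use fr in \<open>auto simp: c_def\<close>)
    have dead: "snd t ''dead'' = snd s ''dead''" using fr(2)[of "''dead''"] by (simp add: c_def s'_def)
    let ?t = "set_reg ''j'' (Suc j) (run c t)"
    show "out_list ?t (L (Suc j)) \<and> fst ?t ''ca'' = length (filter P (take (Suc j) es))"
    proof (cases "P (es ! j)")
      case True
      define t1 where "t1 = set_reg ''o'' (Suc (fst t ''o'')) (set_elem ''out'' (fst t ''o'') (fst (es ! j)) t)"
      have t1: "inp t1" using t by (simp add: t1_def)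
      have o1: "out_list t1 (L j @ [fst (es ! j)])"
        by (rule out_list_append[of t]) (use I in \<open>simp_all add: t1_def\<close>)
      have j1: "fst t1 ''j'' = j" using jj by (simp add: t1_def)
      have run: "run c t = set_reg ''ca'' (Suc (fst t ''ca'')) (set_reg ''o'' (Suc (fst t1 ''o''))
          (set_elem ''out'' (fst t1 ''o'') (snd (es ! j)) t1))"
      proof -
        have "run c t = run (LUpdate ''out'' (Reg ''o'') (tgt ''j'') ;; increment ''o'' ;; increment ''ca'') t1"
          using True t j jj m by (simp add: c_def dead P_def t1_def)
        also have "\<dots> = set_reg ''ca'' (Suc (fst t1 ''ca'')) (set_reg ''o'' (Suc (fst t1 ''o''))
          (set_elem ''out'' (fst t1 ''o'') (snd (es ! j)) t1))"
          using t1 j1 j m by simp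
        finally show ?thesis by (simp add: t1_def)
      qed
      have "out_list ?t ((L j @ [fst (es ! j)]) @ [snd (es ! j)])"
        by (rule out_list_append[OF o1]) (simp_all add: run)
      then show ?thesis using I True j m
        by (simp add: run L_def take_Suc_conv_app_nth case_prod_beta)
    next
      case False
      then have "run c t = t" using t j jj m by (auto simp: c_def dead P_def)
      with False I j m show ?thesis
        by (simp add: L_def take_Suc_conv_app_nth out_list_def)
    qed
  qed (use out in \<open>auto simp: c_def s'_def out_list_def L_def\<close>)
  then show "out_list (run write_arcs s) (xs @ concat (map (\<lambda>(u, v). [u, v]) (filter P es)))"
    "fst (run write_arcs s) ''ca'' = length (filter P es)"
    by (simp_all add: write_arcs_def c_def m L_def flip: s'_def)
qed

lemma val_times_k: "inp s \<Longrightarrow> val (times_k c) s = c * k"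
  by (induction c) auto

lemma output_answer: "output_of (run (answer b) s) = [b]"
  by (simp add: answer_def output_of_def)

lemma output_header:
  assumes "inp s" "out_list s xs"
  shows "output_of (run write_header s) = 2 # [r, k, fst s ''cv'', fst s ''ca''] @ xs"
proof -
  define out where "out = (snd s ''out'')(0 := 2, Suc 0 := r, 2 := k, 3 := fst s ''cv'', 4 := fst s ''ca'')"
  have "output_of (run write_header s) = map out [0..<5 + length xs]"
    using assms by (simp add: write_header_def output_of_def out_def out_list_def)
  also have "[0..<5 + length xs] = [0..<5] @ [5..<5 + length xs]"
    by (rule upt_add_eq_append) simp
  also have "map out ([0..<5] @ [5..<5 + length xs]) = map out [0..<5] @ xs"
  proof -
    have "map out [5..<5 + length xs] = map (snd s ''out'') [5..<5 + length xs]"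
      by (intro map_cong) (auto simp: out_def)
    also have "\<dots> = xs" using assms(2) by (simp add: out_list_def)
    finally show ?thesis by simp
  qed
  also have "map out [0..<5] = [2, r, k, fst s ''cv'', fst s ''ca'']"
    by (simp add: upt_rec out_def)
  finally show ?thesis by simp
qed

lemma output_kernelize:
  fixes c
  defines "A \<equiv> delete_twins E r vs"
  assumes s: "inp s" and fresh: "snd s ''reach'' = (\<lambda>_. 0)" "snd s ''dead'' = (\<lambda>_. 0)"
  shows "output_of (run (kernelize c) s) =
    (if \<not> set vs \<subseteq> E\<^sup>* `` {r} then [0] else if c * k < card A then [1]
     else 2 # iob_code (filter (\<lambda>x. x \<in> A) vs) (filter (\<lambda>e. fst e \<in> A \<and> snd e \<in> A) es) r k)"
proof -
  define s1 where "s1 = run mark_reached s"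
  define s2 where "s2 = run find_unreached s1"
  define s3 where "s3 = run mark_dead s2"
  define s4 where "s4 = run write_verts s3"
  define s5 where "s5 = run write_arcs s4"
  have s1: "inp s1" unfolding s1_def by (rule inp_run[OF s]) auto
  have s2: "inp s2" unfolding s2_def by (rule inp_run[OF s1]) auto
  have s3: "inp s3" unfolding s3_def by (rule inp_run[OF s2]) auto
  have s4: "inp s4" unfolding s4_def by (rule inp_run[OF s3]) auto
  have s5: "inp s5" unfolding s5_def by (rule inp_run[OF s4]) auto
  have "fst s5 ''bad'' = fst s2 ''bad''"
    unfolding s5_def s4_def s3_def by (simp add: run_frame)
  also have "\<dots> = of_bool (\<exists>x\<in>set vs. snd s1 ''reach'' x = 0)"
    unfolding s2_def by (rule find_unreached[OF s1])
  also have "(\<exists>x\<in>set vs. snd s1 ''reach'' x = 0) \<longleftrightarrow> \<not> set vs \<subseteq> E\<^sup>* `` {r}"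
  proof -
    have "snd s1 ''reach'' x = 0 \<longleftrightarrow> (r, x) \<notin> E\<^sup>*" for x
      using mark_reached[OF s fresh(1), of x] unfolding s1_def by linarith
    then show ?thesis by blast
  qed
  finally have bad: "fst s5 ''bad'' = of_bool (\<not> set vs \<subseteq> E\<^sup>* `` {r})" .
  have "snd s2 ''dead'' = (\<lambda>_. 0)"
    unfolding s2_def s1_def by (simp add: run_frame_array fresh)
  from mark_dead[OF s2 this] have dead3: "snd s3 ''dead'' x = 0 \<longleftrightarrow> x \<in> A" if "x \<in> set vs" for x
    using that by (simp add: s3_def A_def)
  then have vs: "filter (\<lambda>x. snd s3 ''dead'' x = 0) vs = filter (\<lambda>x. x \<in> A) vs"
    by (intro filter_cong) auto
  have dead4: "snd s4 ''dead'' = snd s3 ''dead''"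
    unfolding s4_def by (simp add: run_frame_array)
  \<comment> \<open>The meaning of \<open>dead\<close> is established for vertices in
    \<open>vs\<close> only; all ends of arcs are among them.\<close>
  have es: "filter (\<lambda>e. snd s4 ''dead'' (fst e) = 0 \<and> snd s4 ''dead'' (snd e) = 0) es =
      filter (\<lambda>e. fst e \<in> A \<and> snd e \<in> A) es"
    using es_subset dead3 by (intro filter_cong) (auto simp: dead4)
  have out4: "out_list s4 (filter (\<lambda>x. x \<in> A) vs)" "fst s4 ''cv'' = length (filter (\<lambda>x. x \<in> A) vs)"
    using write_verts[OF s3] by (simp_all add: s4_def vs)
  have out5: "out_list s5 (filter (\<lambda>x. x \<in> A) vs @
      concat (map (\<lambda>(u, v). [u, v]) (filter (\<lambda>e. fst e \<in> A \<and> snd e \<in> A) es)))"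
    "fst s5 ''ca'' = length (filter (\<lambda>e. fst e \<in> A \<and> snd e \<in> A) es)"
    using write_arcs[OF s4 out4(1)] by (simp_all add: s5_def es)
  have cv: "fst s5 ''cv'' = length (filter (\<lambda>x. x \<in> A) vs)"
    unfolding s5_def by (simp add: run_frame out4)
  have card: "length (filter (\<lambda>x. x \<in> A) vs) = card A"
    using delete_twins_subset[of E r vs] distinct_vs
    by (simp add: distinct_length_filter A_def Int_absorb2)
  have "run (kernelize c) s = run (LCond (Reg ''bad'') (answer 0)
       (LCond (Monus (Reg ''cv'') (times_k c)) (answer 1) write_header)) s5"
    by (simp add: kernelize_def s1_def s2_def s3_def s4_def s5_def)
  then show ?thesis
    using bad cv card out5 s5
    by (auto simp: val_times_k output_answer output_header iob_code_def not_less)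
qed

end

section \<open>Combining the program with the size bound\<close>

lemma encodes_iff:
  "encodes xs D r k \<longleftrightarrow> (\<exists>vs es. distinct vs \<and> set vs = pverts D \<and> distinct es \<and> set es = parcs D \<and>
     xs = iob_code vs es r k)"
  by (simp add: encodes_def iob_code_def)

text \<open>Loop bounds must be registers, so both list lengths are first loaded from the input
  header. Each load costs 3, which gives the 6 in the time bound.\<close>

definition kernel_program :: "nat \<Rightarrow> com" where
  "kernel_program c = Seq (Assign ''n'' (Elem ''in'' (Num 2)))
     (Seq (Assign ''m'' (Elem ''in'' (Num 3))) (compile (kernelize c)))"

lemma kernel_program_computes:
  assumes D: "iob_instance D r k" and code: "xs = iob_code vs es r k"
    and vs: "distinct vs" "set vs = pverts D" and es: "distinct es" "set es = parcs D"
  defines "A \<equiv> delete_twins (parcs D) r vs"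
  shows "\<exists>t. t \<le> poly ([:6:] + time (kernelize c)) (bit_size xs) \<and>
    computes_in (kernel_program c) xs t
      (if \<not> pverts D \<subseteq> (parcs D)\<^sup>* `` {r} then [0] else if c * k < card A then [1]
       else 2 # iob_code (filter (\<lambda>x. x \<in> A) vs) (filter (\<lambda>e. fst e \<in> A \<and> snd e \<in> A) es) r k)"
proof -
  interpret pair_digraph D using D by (simp add: iob_instance_def)
  have "parcs D \<subseteq> pverts D \<times> pverts D" using in_arcsD1 in_arcsD2 by auto
  then interpret I: iob_input vs es r k
    using D vs es by unfold_locales (auto simp: iob_instance_def)
  define s where "s = set_reg ''m'' (length es) (set_reg ''n'' (length vs) (input_state xs))"
  have inp: "I.inp s"
    by (auto simp: I.inp_def s_def input_state_def code)
  have "length vs \<le> length xs" "length es \<le> length xs"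
    by (simp_all add: code iob_code_def length_concat_pairs)
  then have "fst s b \<le> bit_size xs" if "b \<in> {''n'', ''m''}" for b
    using that length_le_bit_size[of xs] by (auto simp: s_def)
  from exec_compile[OF bounded_by_kernelize this] obtain t
    where t: "t \<le> poly (time (kernelize c)) (bit_size xs)"
      "exec (compile (kernelize c)) s t (run (kernelize c) s)" by blast
  have "exec (Assign ''n'' (Elem ''in'' (Num 2))) (input_state xs) 3 (set_reg ''n'' (length vs) (input_state xs))"
    using exec.Assign[of "''n''" "Elem ''in'' (Num 2)" "fst (input_state xs)" "snd (input_state xs)"]
    by (simp add: set_reg_def input_state_def code iob_code_def numeral_eq_Suc)
  moreover have "exec (Assign ''m'' (Elem ''in'' (Num 3))) (set_reg ''n'' (length vs) (input_state xs)) 3 s"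
    using exec.Assign[of "''m''" "Elem ''in'' (Num 3)" "fst (set_reg ''n'' (length vs) (input_state xs))"
        "snd (set_reg ''n'' (length vs) (input_state xs))"]
    by (simp add: s_def set_reg_def input_state_def code iob_code_def numeral_eq_Suc)
  ultimately have "exec (kernel_program c) (input_state xs) (3 + (3 + t)) (run (kernelize c) s)"
    unfolding kernel_program_def using t(2) by (intro exec.Seq)
  moreover have "snd s ''reach'' = (\<lambda>_. 0)" "snd s ''dead'' = (\<lambda>_. 0)"
    by (auto simp: s_def input_state_def)
  note I.output_kernelize[OF inp this, of c]
  ultimately have "computes_in (kernel_program c) xs (3 + (3 + t))
      (if \<not> pverts D \<subseteq> (parcs D)\<^sup>* `` {r} then [0] else if c * k < card A then [1]
       else 2 # iob_code (filter (\<lambda>x. x \<in> A) vs) (filter (\<lambda>e. fst e \<in> A \<and> snd e \<in> A) es) r k)"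
    unfolding computes_in_def A_def es(2) vs(2) by blast
  moreover have "3 + (3 + t) \<le> poly ([:6:] + time (kernelize c)) (bit_size xs)"
    using t(1) by simp
  ultimately show ?thesis by blast
qed

lemma encodes_kernel:
  assumes vs: "distinct vs" "A \<subseteq> set vs" and es: "distinct es" "set es = parcs D"
  shows "encodes (iob_code (filter (\<lambda>x. x \<in> A) vs) (filter (\<lambda>e. fst e \<in> A \<and> snd e \<in> A) es) r k) (kernel D A) r k"
  unfolding encodes_iff using assms
  by (intro exI[of _ "filter (\<lambda>x. x \<in> A) vs"] exI[of _ "filter (\<lambda>e. fst e \<in> A \<and> snd e \<in> A) es"])
    (auto simp: kernel_def)

theorem theorem2:
  fixes \<G> :: graph_class
  assumes "\<forall>G\<in>\<G>. pair_graph G"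
    and "hereditary \<G>"
    and "bounded_expansion \<G>"
  shows "\<exists>(prog :: com) (p :: nat poly) (c :: nat).
    \<forall>(D :: nat pair_pre_digraph) (r :: nat) (k :: nat) (xs :: nat list).
      iob_instance D r k \<and> mk_symmetric (with_proj D) \<in> \<G> \<and> encodes xs D r k \<longrightarrow>
      (\<exists>t ys. computes_in prog xs t ys \<and> t \<le> poly p (bit_size xs) \<and>
        (ys = [1] \<and> iob_yes D r k \<or>
         ys = [0] \<and> \<not> iob_yes D r k \<or>
         (\<exists>D' zs. ys = 2 # zs \<and> encodes zs D' r k \<and>
            iob_instance D' r k \<and>
            induced_subgraph (with_proj D') (with_proj D) \<and>
            (iob_yes D' r k \<longleftrightarrow> iob_yes D r k) \<and>
            card (pverts D') \<le> c * k)))"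
proof -
  obtain C :: nat where C: "\<And>D. pair_digraph D \<Longrightarrow> mk_symmetric (with_proj D) \<in> \<G> \<Longrightarrow>
      contraction_sparse (pverts D) (parcs D) C"
    using assms(3) by (rule bounded_expansion_contraction_sparse) (rule that)
  \<comment> \<open>The factor 2 comes from the bound \<open>2 * k\<close> on the vertex
    cover.\<close>
  define c where "c = 2 * kernel_factor C"
  show ?thesis
  proof (rule exI[of _ "kernel_program c"], rule exI[of _ "[:6:] + time (kernelize c)"], rule exI[of _ c],
      intro allI impI)
    fix D :: "nat pair_pre_digraph" and r k :: nat and xs :: "nat list"
    assume *: "iob_instance D r k \<and> mk_symmetric (with_proj D) \<in> \<G> \<and> encodes xs D r k"
    then have D: "pair_digraph D" and r: "r \<in> pverts D" by (auto simp: iob_instance_def)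
    interpret pair_digraph D by (rule D)
    from * obtain vs es where vs: "distinct vs" "set vs = pverts D"
      and es: "distinct es" "set es = parcs D" and xs: "xs = iob_code vs es r k"
      unfolding encodes_iff by blast
    define A where "A = delete_twins (parcs D) r vs"
    define ys where "ys = (if \<not> pverts D \<subseteq> (parcs D)\<^sup>* `` {r} then [0] else if c * k < card A then [1]
       else 2 # iob_code (filter (\<lambda>x. x \<in> A) vs) (filter (\<lambda>e. fst e \<in> A \<and> snd e \<in> A) es) r k)"
    obtain t where t: "t \<le> poly ([:6:] + time (kernelize c)) (bit_size xs)"
      "computes_in (kernel_program c) xs t ys"
      using kernel_program_computes[of D r k xs vs es c] * xs vs es unfolding ys_def A_def by blast
    have EV: "parcs D \<subseteq> pverts D \<times> pverts D" using in_arcsD1 in_arcsD2 by auto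
    have "ys = [1] \<and> iob_yes D r k \<or> ys = [0] \<and> \<not> iob_yes D r k \<or>
         (\<exists>D' zs. ys = 2 # zs \<and> encodes zs D' r k \<and> iob_instance D' r k \<and>
            induced_subgraph (with_proj D') (with_proj D) \<and>
            (iob_yes D' r k \<longleftrightarrow> iob_yes D r k) \<and> card (pverts D') \<le> c * k)"
    proof (cases "pverts D \<subseteq> (parcs D)\<^sup>* `` {r}")
      case False
      \<comment> \<open>Without an out-branching the answer is no for every \<open>k\<close>,
        including 0.\<close>
      then have "\<not> iob_yes D r k"
        using ex_branching_iff_reachable[OF EV r] iob_yes_iff_branching[OF D r] by blast
      with False show ?thesis by (simp add: ys_def)
    next
      case reach: True
      show ?thesis
      proof (cases "c * k < card A")
        case True
        then have "iob_yes D r k"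
          using iob_yes_if_many_left[OF D r vs(2) C[OF D] reach] * by (simp add: c_def A_def)
        with reach True show ?thesis by (simp add: ys_def)
      next
        case False
        have A: "A \<subseteq> pverts D" "r \<in> A"
          using delete_twins_subset[of "parcs D" r vs] root_in_delete_twins[of r vs "parcs D"] r vs(2)
          by (auto simp: A_def)
        have "ys = 2 # iob_code (filter (\<lambda>x. x \<in> A) vs) (filter (\<lambda>e. fst e \<in> A \<and> snd e \<in> A) es) r k"
          using reach False by (simp add: ys_def)
        moreover have "card (pverts (kernel D A)) \<le> c * k" using False by (simp add: kernel_def)
        moreover have "iob_yes (kernel D A) r k \<longleftrightarrow> iob_yes D r k"
          unfolding A_def by (rule iob_yes_delete_twins[OF D r vs])
        ultimately show ?thesis
          using kernel_induced[OF D A] encodes_kernel[OF vs(1) _ es, of A r k] A(1) vs(2) by blast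
      qed
    qed
    with t show "\<exists>t ys. computes_in (kernel_program c) xs t ys \<and>
        t \<le> poly ([:6:] + time (kernelize c)) (bit_size xs) \<and>
        (ys = [1] \<and> iob_yes D r k \<or> ys = [0] \<and> \<not> iob_yes D r k \<or>
         (\<exists>D' zs. ys = 2 # zs \<and> encodes zs D' r k \<and> iob_instance D' r k \<and>
            induced_subgraph (with_proj D') (with_proj D) \<and>
            (iob_yes D' r k \<longleftrightarrow> iob_yes D r k) \<and> card (pverts D') \<le> c * k))"
      by blast
  qed
qed

end
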